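(* Let $d\in\{2,3,4,\dots\}$, let $(p_n)_{n\ge 2}$ be a sequence in $[0,1]$, and let $S$ be the conservative random walk on $\mathbb{Z}^d$ started at the origin corresponding to $(p_n)$. Assume that for some $\varepsilon>\varepsilon'>0$ and some $r>1$ the following three conditions hold: $$\limsup_{n\to\infty}\frac{\max_{k\in[0,n^{1-\varepsilon'}]}p_{n-k}}{\min_{k\in[0,n^{1-\varepsilon'}]}p_{n-k}}<r;$$ $$\lim_{n\to\infty}\frac{p_n\,n^{1-\varepsilon}}{\ln n}=\infty;$$ $$\sum_{n=1}^\infty\left(\frac{p_n}{n^{1-\varepsilon}}\right)^{d/2}<\infty,$$ where the maximum and minimum are over integers $k$. Then $\sum_{n=1}^\infty\mathbb{P}(S_n=w)<\infty$ for every $w\in\mathbb{Z}^d$, and the walk $S$ is thus strongly transient, i.e. $|S_n|\to\infty$ almost surely.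
   Context: Conservative random walk on $\mathbb{Z}^d$, $d\ge 2$, corresponding to a sequence $(p_n)_{n\ge 2}$ in $[0,1]$ (with the convention $p_1:=1$): let $e_1,\dots,e_d$ be the standard basis vectors of $\mathbb{R}^d$. Let $Y_1$ be uniform on the $2d$-element set $\{\pm e_1,\dots,\pm e_d\}$, and let $Y_1,Y_2,\dots$ be the (time-inhomogeneous) Markov chain on this set whose transition matrix between times $n$ and $n+1$ is $(1-p_n)I+\frac{p_n}{2d}A$, $n\ge 1$, where $I$ is the $2d\times 2d$ identity matrix and $A$ the $2d\times 2d$ matrix of ones; i.e. with probability $1-p_n$ the next step repeats the previous one, and with probability $p_n$ a fresh direction is chosen uniformly among all $2d$ directions. Set $S_0=\mathbf{0}$, $S_n=Y_1+\dots+Y_n$. $|\cdot|$ is the Euclidean norm. The $\limsup$ condition includes the requirement that the denominator be positive for all sufficiently large $n$ (so $p_n>0$ for all large $n$). *)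

theory Defs
  imports "HOL-Probability.Probability"
begin

definition steps :: "(real ^ 'd) set" where
  "steps = range (\<lambda>i. axis i 1) \<union> range (\<lambda>i. - axis i 1)"

text \<open>Entry at \<open>(y, z)\<close> of the matrix \<open>(1 - p\<^sub>n) I + p\<^sub>n / (2 d) A\<close>, where \<open>A\<close> is the all-ones matrix.\<close>

definition transition :: "(nat \<Rightarrow> real) \<Rightarrow> nat \<Rightarrow> real ^ 'd \<Rightarrow> real ^ 'd \<Rightarrow> real" where
  "transition p n y z = (1 - p n) * (if y = z then 1 else 0) + p n / (2 * real CARD('d))"

text \<open>The steps are indexed from \<open>1\<close>; \<open>Y 0\<close> is irrelevant. The Markov property and the transition
  probabilities are stated together, by conditioning on every trajectory of positive probability.\<close>

locale conservative_random_walk = prob_space M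
  for M :: "'a measure" and p :: "nat \<Rightarrow> real" and Y :: "nat \<Rightarrow> 'a \<Rightarrow> real ^ 'd" +
  assumes step_measurable: "\<And>n. n \<ge> 1 \<Longrightarrow> Y n \<in> M \<rightarrow>\<^sub>M count_space steps"
    and initial: "\<And>y. y \<in> steps \<Longrightarrow> \<P>(\<omega> in M. Y 1 \<omega> = y) = 1 / (2 * real CARD('d))"
    and markov: "\<And>n y. n \<ge> 1 \<Longrightarrow> (\<And>k. k \<in> {1..Suc n} \<Longrightarrow> y k \<in> steps) \<Longrightarrow>
      \<P>(\<omega> in M. \<forall>k\<in>{1..n}. Y k \<omega> = y k) > 0 \<Longrightarrow>
      \<P>(\<omega> in M. Y (Suc n) \<omega> = y (Suc n) \<bar> \<forall>k\<in>{1..n}. Y k \<omega> = y k)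
        = transition p n (y n) (y (Suc n))"

definition walk :: "(nat \<Rightarrow> 'a \<Rightarrow> real ^ 'd) \<Rightarrow> nat \<Rightarrow> 'a \<Rightarrow> real ^ 'd" where
  "walk Y n \<omega> = (\<Sum>k=1..n. Y k \<omega>)"

definition integer_lattice :: "(real ^ 'd) set" where
  "integer_lattice = {w. \<forall>i. w $ i \<in> \<int>}"

definition strongly_transient :: "'a measure \<Rightarrow> (nat \<Rightarrow> 'a \<Rightarrow> real ^ 'd) \<Rightarrow> bool" where
  "strongly_transient M S \<longleftrightarrow>
     (AE \<omega> in M. filterlim (\<lambda>n. norm (S n \<omega>)) at_top sequentially)"

text \<open>Maximum and minimum of \<open>p (n - k)\<close> over integers \<open>k \<in> [0, n powr a]\<close>. When \<open>a < 1\<close> and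
  \<open>n \<ge> 2\<close>, all such \<open>k\<close> are smaller than \<open>n\<close>, so the subtraction does not truncate and \<open>p 0\<close> is
  not used.\<close>

definition window_max :: "(nat \<Rightarrow> real) \<Rightarrow> real \<Rightarrow> nat \<Rightarrow> real" where
  "window_max p a n = Max ((\<lambda>k. p (n - k)) ` {k. real k \<le> real n powr a})"

definition window_min :: "(nat \<Rightarrow> real) \<Rightarrow> real \<Rightarrow> nat \<Rightarrow> real" where
  "window_min p a n = Min ((\<lambda>k. p (n - k)) ` {k. real k \<le> real n powr a})"

end

theory Submission
  imports Defs
begin

text \<open>The characteristic function of the walk is a product of the maps \<open>f \<mapsto> D ((1 - p\<^sub>k) f + p\<^sub>k mean f)\<close> on
  functions on the \<open>2d\<close> directions, where \<open>D\<close> multiplies by the phases \<open>exp (i \<theta> \<bullet> y)\<close>. Such a map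
  decreases the squared norm by at least \<open>p\<^sub>k\<close> times the squared deviation of \<open>f\<close> from its mean. Over a
  block of \<open>B\<close> steps, \<open>B\<close> about \<open>2/p\<close>, either the total loss is already large, or \<open>f\<close> stays close to
  \<open>D\<^sup>k f\<close>, whose deviation cannot remain small because the phases rotate apart. So a block contracts the
  squared norm by a factor \<open>1 - c min(1, B |sin \<theta>\<^sub>i|)\<^sup>2\<close>. The last \<open>n powr (1 - \<epsilon>')\<close> steps contain many blocks
  on which \<open>p\<close> is constant up to the factor \<open>r\<close>; averaging over a grid of frequencies gives
  \<open>P(S\<^sub>n = w) \<le> n\<^sup>-\<^sup>2 + K (p\<^sub>n / n powr (1 - \<epsilon>)) powr (d/2)\<close>, and Borel-Cantelli finishes the proof.\<close>

subsection \<open>Energy and deviation from the mean\<close>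

definition mean :: "'b set \<Rightarrow> ('b \<Rightarrow> complex) \<Rightarrow> complex" where
  "mean A f = (\<Sum>y\<in>A. f y) / of_nat (card A)"

definition energy :: "'b set \<Rightarrow> ('b \<Rightarrow> complex) \<Rightarrow> real" where
  "energy A f = (\<Sum>y\<in>A. (cmod (f y))\<^sup>2)"

text \<open>For finite nonempty \<open>A\<close>, this is \<open>card A\<close> times the variance
  of \<open>f\<close> under the uniform law, equivalently the squared distance of \<open>f\<close>
  to the constants.\<close>

definition deviation :: "'b set \<Rightarrow> ('b \<Rightarrow> complex) \<Rightarrow> real" where
  "deviation A f = energy A (\<lambda>y. f y - mean A f)"

lemma energy_nonneg: "energy A f \<ge> 0"
  by (simp add: energy_def sum_nonneg)

lemma deviation_nonneg: "deviation A f \<ge> 0"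
  by (simp add: deviation_def energy_nonneg)

lemma energy_unit_mult:
  assumes "\<And>y. y \<in> A \<Longrightarrow> cmod (u y) = 1"
  shows "energy A (\<lambda>y. u y * f y) = energy A f"
  using assms by (simp add: energy_def norm_mult)

lemma sq_norm_diff_le: "(norm (a - b))\<^sup>2 \<le> 2 * (norm a)\<^sup>2 + 2 * (norm (b :: 'a :: real_inner))\<^sup>2"
proof -
  have "(norm (a - b))\<^sup>2 + (norm (a + b))\<^sup>2 = 2 * (norm a)\<^sup>2 + 2 * (norm b)\<^sup>2"
    by (simp add: power2_norm_eq_inner inner_simps inner_commute)
  then show ?thesis by (smt (verit) zero_le_power2)
qed

text \<open>Pythagoras: \<open>f y - mean A f\<close> sums to zero, so it is orthogonal to
  constants. The case \<open>t = 1\<close> splits the energy, and \<open>t = 1 - p\<close> is one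
  averaging step.\<close>

lemma energy_affine:
  assumes "finite A" "A \<noteq> {}"
  shows "energy A (\<lambda>y. of_real t * (f y - mean A f) + mean A f)
    = t\<^sup>2 * deviation A f + real (card A) * (cmod (mean A f))\<^sup>2"
proof -
  let ?m = "mean A f"
  have "(\<Sum>y\<in>A. f y - ?m) = 0"
    using assms by (simp add: sum_subtractf mean_def)
  then have z: "(\<Sum>y\<in>A. inner (f y - ?m) ?m) = 0"
    by (metis inner_sum_left inner_zero_left)
  have "(cmod (of_real t * (f y - ?m) + ?m))\<^sup>2
      = t\<^sup>2 * (cmod (f y - ?m))\<^sup>2 + 2 * t * inner (f y - ?m) ?m + (cmod ?m)\<^sup>2" for y
    unfolding scaleR_conv_of_real[symmetric]
    unfolding power2_norm_eq_inner inner_add_left inner_add_right inner_scaleR_left inner_scaleR_right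
    using inner_commute[of "mean A f" "f y - mean A f"] by (simp add: power2_eq_square algebra_simps)
  then have "energy A (\<lambda>y. of_real t * (f y - ?m) + ?m)
      = t\<^sup>2 * deviation A f + 2 * t * (\<Sum>y\<in>A. inner (f y - ?m) ?m) + real (card A) * (cmod ?m)\<^sup>2"
    by (simp add: energy_def deviation_def sum.distrib sum_distrib_left)
  with z show ?thesis by simp
qed

lemma energy_decomp:
  assumes "finite A" "A \<noteq> {}"
  shows "energy A f = deviation A f + real (card A) * (cmod (mean A f))\<^sup>2"
  using energy_affine[OF assms, of 1 f] by simp

lemma deviation_le_energy:
  assumes "finite A" "A \<noteq> {}"
  shows "deviation A f \<le> energy A f"
  using energy_decomp[OF assms, of f] by simp

lemma energy_diff_le: "energy A (\<lambda>y. f y - g y) \<le> 2 * energy A f + 2 * energy A g"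
  unfolding energy_def sum_distrib_left sum.distrib[symmetric]
  by (intro sum_mono sq_norm_diff_le)

text \<open>Subtracting the mean is linear and does not increase the energy. This passes from the
  true iterates to their freely rotating approximations.\<close>

lemma deviation_le_deviation:
  assumes "finite A" "A \<noteq> {}"
  shows "deviation A g \<le> 2 * deviation A h + 2 * energy A (\<lambda>y. h y - g y)"
proof -
  have m: "mean A (\<lambda>y. h y - g y) = mean A h - mean A g"
    by (simp add: mean_def sum_subtractf diff_divide_distrib)
  have "deviation A g = energy A (\<lambda>y. (h y - mean A h) - ((h y - g y) - mean A (\<lambda>y. h y - g y)))"
    unfolding deviation_def m by (simp add: algebra_simps)
  also have "\<dots> \<le> 2 * deviation A h + 2 * deviation A (\<lambda>y. h y - g y)"
    unfolding deviation_def by (rule energy_diff_le)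
  also have "\<dots> \<le> 2 * deviation A h + 2 * energy A (\<lambda>y. h y - g y)"
    using deviation_le_energy[OF assms] by (simp)
  finally show ?thesis .
qed

lemma sq_diff_le_deviation:
  assumes "finite A" "y \<in> A" "z \<in> A"
  shows "(cmod (g y - g z))\<^sup>2 \<le> 2 * deviation A g"
proof (cases "y = z")
  case True then show ?thesis by (simp add: deviation_nonneg)
next
  case False
  let ?m = "mean A g"
  have "(cmod (g y - g z))\<^sup>2 = (cmod ((g y - ?m) - (g z - ?m)))\<^sup>2" by simp
  also have "\<dots> \<le> 2 * (cmod (g y - ?m))\<^sup>2 + 2 * (cmod (g z - ?m))\<^sup>2"
    by (rule sq_norm_diff_le)
  also have "\<dots> = 2 * (\<Sum>x\<in>{y,z}. (cmod (g x - ?m))\<^sup>2)"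
    using False by simp
  also have "\<dots> \<le> 2 * deviation A g"
    unfolding deviation_def energy_def using assms
    by (intro mult_left_mono sum_mono2) auto
  finally show ?thesis .
qed

subsection \<open>Rotating phases\<close>

text \<open>A weak Jordan inequality, from \<open>sin x >= x - x^3 / 6\<close>: the upper end pi/2
  is below 1.6, so \<open>x^2 <= 3\<close> on the whole interval.\<close>

lemma half_le_sin:
  fixes x :: real
  assumes "0 \<le> x" "x \<le> pi / 2"
  shows "x / 2 \<le> sin x"
proof -
  have "\<bar>sin x - (\<Sum>m<3. sin_coeff m * x ^ m)\<bar> \<le> inverse (fact 3) * \<bar>x\<bar> ^ 3"
    by (rule Maclaurin_sin_bound)
  then have "\<bar>sin x - x\<bar> \<le> x ^ 3 / 6"
    using assms by (simp add: eval_nat_numeral sin_coeff_def fact_numeral)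
  then have 1: "sin x \<ge> x - x ^ 3 / 6" by linarith
  have "x \<le> 1.6" using assms pi_approx by simp
  then have "x\<^sup>2 \<le> 1.6\<^sup>2" using assms by (intro power_mono) auto
  then have "x\<^sup>2 \<le> 3" by (simp add: power2_eq_square)
  then have "x * x\<^sup>2 \<le> x * 3" using assms by (intro mult_left_mono) auto
  then have "x ^ 3 \<le> 3 * x" by (simp add: power3_eq_cube power2_eq_square)
  with 1 show ?thesis by simp
qed

lemma cmod_cis_minus_1: "cmod (cis t - 1) = 2 * \<bar>sin (t / 2)\<bar>"
  using dist_exp_i_1[of t] by (simp add: cis_conv_exp)

lemma cmod_cis_minus_1_ge:
  assumes "\<bar>t\<bar> \<le> pi"
  shows "\<bar>t\<bar> / 2 \<le> cmod (cis t - 1)"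
proof -
  have "\<bar>sin (t / 2)\<bar> = \<bar>sin (\<bar>t\<bar> / 2)\<bar>" by (simp add: abs_if)
  moreover have "\<bar>t\<bar> / 2 / 2 \<le> sin (\<bar>t\<bar> / 2)" using assms by (intro half_le_sin) auto
  ultimately show ?thesis by (simp add: cmod_cis_minus_1)
qed

lemma cmod_cis_minus_1_le: "cmod (cis t - 1) \<le> \<bar>t\<bar>"
  using abs_sin_x_le_abs_x[of "t/2"] by (simp add: cmod_cis_minus_1)

text \<open>The power is \<open>B div 2\<close> if the angle \<open>t\<close> of \<open>w\<close> is below \<open>2 / B\<close>, and about \<open>1 / t\<close> otherwise.\<close>

lemma exists_separating_power:
  assumes w: "cmod w = 1" and B: "B \<ge> (2::nat)"
  obtains s where "2 * s \<le> B" "cmod (w ^ s - 1) \<ge> min 1 (real B * cmod (w - 1)) / 6"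
proof -
  define t where "t = Arg w"
  have wt: "w = cis t" unfolding t_def using cis_Arg[of w] w by (metis div_by_1 norm_zero of_real_1 sgn_eq zero_neq_one)
  have t: "\<bar>t\<bar> \<le> pi" using Arg_bounded[of w] by (auto simp: t_def)
  have ws: "w ^ s = cis (real s * t)" for s unfolding wt by (rule Complex.DeMoivre)
  have lower: "cmod (w ^ s - 1) \<ge> real s * \<bar>t\<bar> / 2" if "real s * \<bar>t\<bar> \<le> pi" for s
    using cmod_cis_minus_1_ge[of "real s * t"] that by (simp add: ws abs_mult)
  have up: "cmod (w - 1) \<le> \<bar>t\<bar>" by (simp add: wt cmod_cis_minus_1_le)
  consider "real B * \<bar>t\<bar> \<le> 2" | "real B * \<bar>t\<bar> > 2" "\<bar>t\<bar> < 1" | "\<bar>t\<bar> \<ge> 1" by linarith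
  then show thesis
  proof cases
    case 1
    \<comment> \<open>For \<open>B >= 2\<close> the integer half is at least \<open>B / 3\<close>,
      with equality at 3. Hence \<open>s * \<bar>t\<bar> / 2\<close> is at least
      \<open>B * \<bar>t\<bar> / 6\<close>, the source of the 6.\<close>
    define s where "s = B div 2"
    have s: "2 * s \<le> B" "3 * s \<ge> B" using B by (auto simp: s_def)
    have "2 * real s \<le> real B" using s by linarith
    then have "2 * real s * \<bar>t\<bar> \<le> real B * \<bar>t\<bar>" by (rule mult_right_mono) simp
    then have "real s * \<bar>t\<bar> \<le> pi" using 1 pi_gt3 by linarith
    then have a: "cmod (w ^ s - 1) \<ge> real s * \<bar>t\<bar> / 2" by (rule lower)
    have "real B \<le> 3 * real s" using s by linarith
    then have "real B * \<bar>t\<bar> \<le> 3 * real s * \<bar>t\<bar>" by (rule mult_right_mono) simp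
    moreover have "real B * cmod (w - 1) \<le> real B * \<bar>t\<bar>" using up by (intro mult_left_mono) auto
    ultimately have "real B * cmod (w - 1) \<le> 6 * cmod (w ^ s - 1)" using a by linarith
    then show thesis using s that[of s] by linarith
  next
    case 2
    then have tp: "\<bar>t\<bar> > 0" by (metis abs_ge_zero less_eq_real_def mult_zero_right not_numeral_less_zero) 
    \<comment> \<open>Rounding \<open>1 / \<bar>t\<bar>\<close> down puts the angle
      \<open>s * \<bar>t\<bar>\<close> in (1/2, 1], a constant distance away from 0.\<close>
    define s where "s = nat \<lfloor>1 / \<bar>t\<bar>\<rfloor>"
    have i: "1 / \<bar>t\<bar> > 1" using 2 tp by simp
    have s1: "real s \<le> 1 / \<bar>t\<bar>" "real s > 1 / \<bar>t\<bar> - 1" "s \<ge> 1"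
      using i unfolding s_def by linarith+
    have "real s * \<bar>t\<bar> \<le> 1" using s1(1) tp by (simp add: field_simps)
    moreover have "1 / \<bar>t\<bar> < 2 * real s" using s1 by linarith
    then have "real s * \<bar>t\<bar> > 1/2" using tp by (simp add: field_simps)
    ultimately have "cmod (w ^ s - 1) \<ge> 1 / 4" using lower[of s] pi_gt3 by linarith
    moreover have "2 * (1 / \<bar>t\<bar>) < real B" using 2 tp by (simp add: field_simps)
    then have "2 * s \<le> B" using s1(1) by linarith
    ultimately show thesis using that[of s] by linarith
  next
    case 3
    have "cmod (w ^ 1 - 1) \<ge> 1/2" using lower[of 1] t 3 by simp
    then show thesis using that[of 1] B by linarith
  qed
qed

text \<open>Up to a unimodular factor the summand is \<open>w ^ k * a - b\<close> with
  \<open>w = u * cnj v\<close>. Subtracting the terms at \<open>k\<close> and \<open>k + s\<close>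
  cancels \<open>b\<close> and leaves modulus \<open>cmod a * cmod (w ^ s - 1)\<close>, so the two
  cannot both be small. At least \<open>B / 2\<close> such pairs exist, and 288 = 2 * 4 *
  36.\<close>

lemma sum_rotating_diff_ge:
  assumes u: "cmod u = 1" and v: "cmod v = 1" and B: "B \<ge> (2::nat)"
  shows "real B * (min 1 (real B * cmod (u - v)))\<^sup>2 / 288 * (cmod a)\<^sup>2
    \<le> (\<Sum>k<B. (cmod (u ^ k * a - v ^ k * b))\<^sup>2)"
proof -
  define w where "w = u * cnj v"
  have vv: "v * cnj v = 1" using v by (simp add: complex_norm_square[symmetric])
  have vn: "v \<noteq> 0" using v by auto
  have uw: "u = v * w" using vv by (simp add: w_def algebra_simps)
  have w1: "cmod w = 1" by (simp add: w_def norm_mult u v)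
  have "u - v = v * (w - 1)" by (simp add: uw algebra_simps)
  then have wd: "cmod (w - 1) = cmod (u - v)" by (simp add: norm_mult v)
  obtain s where s: "2 * s \<le> B" "cmod (w ^ s - 1) \<ge> min 1 (real B * cmod (u - v)) / 6"
    using exists_separating_power[OF w1 B] wd by metis
  define g where "g k = (cmod (w ^ k * a - b))\<^sup>2" for k
  have g: "(cmod (u ^ k * a - v ^ k * b))\<^sup>2 = g k" for k
  proof -
    have "u ^ k * a - v ^ k * b = v ^ k * (w ^ k * a - b)"
      by (simp add: uw power_mult_distrib algebra_simps)
    then show ?thesis by (simp add: norm_mult norm_power v g_def)
  qed
  have pair: "(cmod a)\<^sup>2 * (cmod (w ^ s - 1))\<^sup>2 \<le> 2 * g (k + s) + 2 * g k" for k
  proof -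
    have "(w ^ (k + s) * a - b) - (w ^ k * a - b) = w ^ k * (a * (w ^ s - 1))"
      by (simp add: power_add algebra_simps)
    then have "cmod a * cmod (w ^ s - 1) = cmod ((w ^ (k + s) * a - b) - (w ^ k * a - b))"
      by (simp add: norm_mult norm_power w1)
    then show ?thesis unfolding g_def power_mult_distrib[symmetric]
      using sq_norm_diff_le by metis
  qed
  have gn: "g k \<ge> 0" for k by (simp add: g_def)
  \<comment> \<open>Each index below \<open>B\<close> occurs at most once as \<open>k\<close> and
    once as \<open>k + s\<close>, whence the factor 4 = 2 + 2.\<close>
  have "real (B - s) * ((cmod a)\<^sup>2 * (cmod (w ^ s - 1))\<^sup>2) = (\<Sum>k<B - s. (cmod a)\<^sup>2 * (cmod (w ^ s - 1))\<^sup>2)"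
    by simp
  also have "\<dots> \<le> (\<Sum>k<B - s. 2 * g (k + s) + 2 * g k)" by (intro sum_mono pair)
  also have "\<dots> = 2 * (\<Sum>k<B - s. g (k + s)) + 2 * (\<Sum>k<B - s. g k)"
    by (simp add: sum.distrib sum_distrib_left)
  also have "(\<Sum>k<B - s. g (k + s)) = sum g ((\<lambda>k. k + s) ` {..<B - s})"
    by (simp add: sum.reindex inj_on_def)
  also have "\<dots> \<le> sum g {..<B}" by (intro sum_mono2) (auto simp: gn)
  also have "(\<Sum>k<B - s. g k) \<le> sum g {..<B}" by (intro sum_mono2) (auto simp: gn)
  finally have 1: "real (B - s) * ((cmod a)\<^sup>2 * (cmod (w ^ s - 1))\<^sup>2) \<le> 4 * sum g {..<B}" by simp
  have "(min 1 (real B * cmod (u - v)) / 6)\<^sup>2 \<le> (cmod (w ^ s - 1))\<^sup>2"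
    using s by (intro power_mono) auto
  then have "real B / 2 * ((cmod a)\<^sup>2 * (min 1 (real B * cmod (u - v)) / 6)\<^sup>2)
      \<le> real (B - s) * ((cmod a)\<^sup>2 * (cmod (w ^ s - 1))\<^sup>2)"
    using s(1) by (intro mult_mono mult_left_mono) auto
  with 1 show ?thesis unfolding g by (simp add: power_divide field_simps)
qed

subsection \<open>Contraction under averaging\<close>

lemma energy_cong: "(\<And>y. y \<in> A \<Longrightarrow> f y = g y) \<Longrightarrow> energy A f = energy A g"
  by (simp add: energy_def)

text \<open>The phases preserve the energy, while averaging scales the component orthogonal to
  constants by \<open>1 - p\<close>. The loss factor \<open>1 - (1 - p)^2\<close> is at least
  \<open>p\<close> on [0, 1].\<close>

lemma energy_averaging_step:
  assumes "finite A" "A \<noteq> {}" "\<And>y. y \<in> A \<Longrightarrow> cmod (u y) = 1" "p \<in> {0..1}"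
    and f': "\<And>y. y \<in> A \<Longrightarrow> f' y = u y * (of_real (1 - p) * f y + of_real p * mean A f)"
  shows "energy A f' \<le> energy A f - p * deviation A f"
proof -
  have "energy A f' = energy A (\<lambda>y. u y * (of_real (1 - p) * (f y - mean A f) + mean A f))"
    by (intro energy_cong) (simp add: f' algebra_simps)
  also have "\<dots> = energy A (\<lambda>y. of_real (1 - p) * (f y - mean A f) + mean A f)"
    by (rule energy_unit_mult[OF assms(3)])
  also have "\<dots> = (1 - p)\<^sup>2 * deviation A f + real (card A) * (cmod (mean A f))\<^sup>2"
    by (rule energy_affine[OF assms(1,2)])
  also have "\<dots> = energy A f - (1 - (1 - p)\<^sup>2) * deviation A f"
    by (simp add: energy_decomp[OF assms(1,2), of f] algebra_simps)
  also have "\<dots> \<le> energy A f - p * deviation A f"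
  proof -
    have "p * p \<le> p * 1" using assms(4) by (intro mult_left_mono) auto
    then have "p \<le> 1 - (1 - p)\<^sup>2" by (simp add: power2_eq_square algebra_simps)
    then have "p * deviation A f \<le> (1 - (1 - p)\<^sup>2) * deviation A f"
      by (intro mult_right_mono deviation_nonneg)
    then show ?thesis by simp
  qed
  finally show ?thesis .
qed

lemma weighted_sum_squared_le:
  fixes p x :: "'i \<Rightarrow> real"
  assumes "\<And>i. i \<in> I \<Longrightarrow> p i \<ge> 0"
  shows "(\<Sum>i\<in>I. p i * x i)\<^sup>2 \<le> (\<Sum>i\<in>I. p i) * (\<Sum>i\<in>I. p i * (x i)\<^sup>2)"
proof -
  have "(\<Sum>i\<in>I. p i * x i)\<^sup>2 = (\<Sum>i\<in>I. sqrt (p i) * (sqrt (p i) * x i))\<^sup>2"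
    using assms by (intro arg_cong[where f="\<lambda>x. x\<^sup>2"] sum.cong) (auto simp: algebra_simps)
  also have "\<dots> \<le> (\<Sum>i\<in>I. (sqrt (p i))\<^sup>2) * (\<Sum>i\<in>I. (sqrt (p i) * x i)\<^sup>2)"
    by (rule Cauchy_Schwarz_ineq_sum)
  also have "\<dots> = (\<Sum>i\<in>I. p i) * (\<Sum>i\<in>I. p i * (x i)\<^sup>2)"
    using assms by (simp add: power_mult_distrib)
  finally show ?thesis .
qed

text \<open>The sum \<Delta> bounds the energy loss from below. If it were small, Cauchy-Schwarz
  would keep \<open>f k\<close> close to the pure rotation \<open>u ^ k * f 0\<close>, whose
  deviation would then be small on average over the block. The separation of the phases forbids
  this, so \<Delta> is at least a fixed fraction of the initial energy.\<close>

lemma energy_averaging_block: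
  fixes f :: "nat \<Rightarrow> 'b \<Rightarrow> complex"
  assumes A: "finite A" "A \<noteq> {}" and u: "\<And>y. y \<in> A \<Longrightarrow> cmod (u y) = 1"
    and step: "\<And>k y. k < B \<Longrightarrow> y \<in> A \<Longrightarrow>
      f (Suc k) y = u y * (of_real (1 - p k) * f k y + of_real (p k) * mean A (f k))"
    and p: "\<And>k. k < B \<Longrightarrow> q \<le> p k" "\<And>k. k < B \<Longrightarrow> p k \<le> r * q" "\<And>k. k < B \<Longrightarrow> p k \<le> 1"
    and q: "q > 0" and r: "r \<ge> 1" and B: "B \<ge> 2" "2 \<le> q * real B" "q * real B \<le> 3"
    and sep: "\<And>y. y \<in> A \<Longrightarrow> \<exists>z\<in>A. cmod (u y - u z) \<ge> \<sigma>" and \<sigma>: "\<sigma> \<ge> 0"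
  shows "energy A (f B)
    \<le> (1 - (min 1 (real B * \<sigma>))\<^sup>2 / (288 * (2 + 18 * r) * real (card A))) * energy A (f 0)"
proof -
  define \<Delta> where "\<Delta> = (\<Sum>k<B. p k * deviation A (f k))"
  have p0: "p k \<ge> 0" if "k < B" for k using p(1)[OF that] q by linarith
  have "k \<le> B \<Longrightarrow> energy A (f k) \<le> energy A (f 0) - (\<Sum>j<k. p j * deviation A (f j))" for k
  proof (induction k)
    case (Suc k)
    then have k: "k < B" by simp
    then have "energy A (f (Suc k)) \<le> energy A (f k) - p k * deviation A (f k)"
      using p0[OF k] p(3)[OF k] by (intro energy_averaging_step[OF A u _ step[OF k]]) auto
    with Suc show ?case by simp
  qed simp
  then have decay: "energy A (f B) \<le> energy A (f 0) - \<Delta>" by (simp add: \<Delta>_def)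
  have \<Delta>0: "\<Delta> \<ge> 0" unfolding \<Delta>_def by (intro sum_nonneg mult_nonneg_nonneg p0 deviation_nonneg) auto
  \<comment> \<open>Each step departs from pure rotation by \<open>p k\<close> times the distance to
    the mean, and unimodular phases do not amplify earlier errors.\<close>
  have drift: "k \<le> B \<Longrightarrow> y \<in> A \<Longrightarrow>
      cmod (f k y - u y ^ k * f 0 y) \<le> (\<Sum>j<k. p j * cmod (f j y - mean A (f j)))" for k y
  proof (induction k)
    case (Suc k)
    then have k: "k < B" by simp
    have "f (Suc k) y - u y ^ Suc k * f 0 y
        = u y * ((f k y - u y ^ k * f 0 y) - of_real (p k) * (f k y - mean A (f k)))"
      by (simp add: step[OF k Suc.prems(2)] algebra_simps)
    then have "cmod (f (Suc k) y - u y ^ Suc k * f 0 y)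
        = cmod ((f k y - u y ^ k * f 0 y) - of_real (p k) * (f k y - mean A (f k)))"
      by (simp add: norm_mult u Suc.prems del: power_Suc)
    also have "\<dots> \<le> cmod (f k y - u y ^ k * f 0 y) + p k * cmod (f k y - mean A (f k))"
      by (rule order_trans[OF norm_triangle_ineq4]) (simp add: norm_mult p0 k)
    finally show ?case using Suc by simp
  qed simp
  have drift_energy: "energy A (\<lambda>y. f k y - u y ^ k * f 0 y) \<le> 3 * r * \<Delta>" if k: "k < B" for k
  proof -
    have "energy A (\<lambda>y. f k y - u y ^ k * f 0 y)
        \<le> (\<Sum>y\<in>A. (\<Sum>j<k. p j * cmod (f j y - mean A (f j)))\<^sup>2)"
      unfolding energy_def using k by (intro sum_mono power_mono drift) auto
    \<comment> \<open>With the weights \<open>p j\<close>, the second factor summed over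
      \<open>A\<close> is a partial sum of \<Delta>. The first is at most \<open>r * q * B\<close>,
      hence at most \<open>3 * r\<close>.\<close>
    also have "\<dots> \<le> (\<Sum>y\<in>A. (\<Sum>j<k. p j) * (\<Sum>j<k. p j * (cmod (f j y - mean A (f j)))\<^sup>2))"
      using k by (intro sum_mono weighted_sum_squared_le p0) auto
    also have "\<dots> = (\<Sum>j<k. p j) * (\<Sum>j<k. p j * deviation A (f j))"
      unfolding deviation_def energy_def sum_distrib_left[symmetric]
      by (subst sum.swap) (simp add: sum_distrib_left)
    also have "\<dots> \<le> 3 * r * \<Delta>"
    proof (intro mult_mono)
      have "(\<Sum>j<k. p j) \<le> (\<Sum>j<B. p j)" using k by (intro sum_mono2) (auto intro: p0)
      also have "\<dots> \<le> (\<Sum>j<B. r * q)" using p by (intro sum_mono) auto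
      also have "\<dots> = r * (q * real B)" by simp
      also have "\<dots> \<le> r * 3" using r B by (intro mult_left_mono) auto
      finally show "(\<Sum>j<k. p j) \<le> 3 * r" by simp
      show "(\<Sum>j<k. p j * deviation A (f j)) \<le> \<Delta>"
        unfolding \<Delta>_def using k by (intro sum_mono2) (auto intro!: mult_nonneg_nonneg p0 deviation_nonneg)
    qed (use r k in \<open>auto intro!: sum_nonneg mult_nonneg_nonneg p0 deviation_nonneg\<close>)
    finally show ?thesis .
  qed
  define D where "D = (\<Sum>k<B. deviation A (\<lambda>y. u y ^ k * f 0 y))"
  \<comment> \<open>The rotation at time \<open>k\<close> has deviation at most twice that of
    \<open>f k\<close> plus \<open>6 * r * \<Delta>\<close>. The weight \<open>q <= p k\<close>
    turns the first part into \<open>2 * \<Delta>\<close>, and \<open>q * B <= 3\<close> turns the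
    second into \<open>18 * r * \<Delta>\<close>.\<close>
  have upper: "q * D \<le> (2 + 18 * r) * \<Delta>"
  proof -
    have "q * D = (\<Sum>k<B. q * deviation A (\<lambda>y. u y ^ k * f 0 y))"
      by (simp add: D_def sum_distrib_left)
    also have "\<dots> \<le> (\<Sum>k<B. 2 * (p k * deviation A (f k)) + 6 * r * \<Delta> * q)"
    proof (intro sum_mono)
      fix k assume "k \<in> {..<B}"
      then have k: "k < B" by simp
      have "deviation A (\<lambda>y. u y ^ k * f 0 y) \<le> 2 * deviation A (f k) + 6 * r * \<Delta>"
        using deviation_le_deviation[OF A, of "\<lambda>y. u y ^ k * f 0 y" "f k"] drift_energy[OF k] by linarith
      then have "q * deviation A (\<lambda>y. u y ^ k * f 0 y) \<le> q * (2 * deviation A (f k) + 6 * r * \<Delta>)"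
        using q by (intro mult_left_mono) auto
      also have "\<dots> = 2 * (q * deviation A (f k)) + 6 * r * \<Delta> * q" by (simp add: algebra_simps)
      also have "q * deviation A (f k) \<le> p k * deviation A (f k)"
        using p(1)[OF k] by (intro mult_right_mono deviation_nonneg)
      finally show "q * deviation A (\<lambda>y. u y ^ k * f 0 y) \<le> 2 * (p k * deviation A (f k)) + 6 * r * \<Delta> * q"
        by simp
    qed
    also have "\<dots> = 2 * \<Delta> + 6 * r * \<Delta> * (q * real B)"
      by (simp add: sum.distrib \<Delta>_def sum_distrib_left[symmetric])
    also have "6 * r * \<Delta> * (q * real B) \<le> 6 * r * \<Delta> * 3"
      using B r \<Delta>0 by (intro mult_left_mono) auto
    finally show ?thesis by (simp add: algebra_simps)
  qed
  \<comment> \<open>576 is twice 288, because a squared difference of two values is at most twice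
    the deviation. Summing over \<open>y\<close> costs the factor \<open>card A\<close>.\<close>
  have lower: "real B * (min 1 (real B * \<sigma>))\<^sup>2 / 576 * energy A (f 0) \<le> real (card A) * D"
  proof -
    have "real B * (min 1 (real B * \<sigma>))\<^sup>2 / 576 * (cmod (f 0 y))\<^sup>2 \<le> D" if y: "y \<in> A" for y
    proof -
      obtain z where z: "z \<in> A" "cmod (u y - u z) \<ge> \<sigma>" using sep[OF y] by blast
      have "(min 1 (real B * \<sigma>))\<^sup>2 \<le> (min 1 (real B * cmod (u y - u z)))\<^sup>2"
        using z(2) \<sigma> by (intro power_mono min.mono mult_left_mono) auto
      then have "real B * (min 1 (real B * \<sigma>))\<^sup>2 / 288 * (cmod (f 0 y))\<^sup>2
          \<le> real B * (min 1 (real B * cmod (u y - u z)))\<^sup>2 / 288 * (cmod (f 0 y))\<^sup>2"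
        by (intro mult_right_mono divide_right_mono mult_left_mono) auto
      also have "\<dots> \<le> (\<Sum>k<B. (cmod (u y ^ k * f 0 y - u z ^ k * f 0 z))\<^sup>2)"
        by (rule sum_rotating_diff_ge[OF u[OF y] u[OF z(1)] B(1)])
      also have "\<dots> \<le> (\<Sum>k<B. 2 * deviation A (\<lambda>y. u y ^ k * f 0 y))"
        by (intro sum_mono sq_diff_le_deviation[OF A(1) y z(1)])
      also have "\<dots> = 2 * D" by (simp add: D_def sum_distrib_left)
      finally show ?thesis by simp
    qed
    then have "(\<Sum>y\<in>A. real B * (min 1 (real B * \<sigma>))\<^sup>2 / 576 * (cmod (f 0 y))\<^sup>2) \<le> (\<Sum>y\<in>A. D)"
      by (rule sum_mono)
    then show ?thesis by (simp add: energy_def sum_distrib_left)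
  qed
  let ?m = "(min 1 (real B * \<sigma>))\<^sup>2" and ?E = "energy A (f 0)"
  \<comment> \<open>The bound \<open>2 <= q * B\<close> makes the contraction rate depend on the
    block length only through \<open>min 1 (B * \<sigma>)\<close>.\<close>
  have "2 * (?m / 576 * ?E) \<le> (q * real B) * (?m / 576 * ?E)"
    using B by (intro mult_right_mono) (auto simp: energy_nonneg)
  also have "\<dots> = q * (real B * ?m / 576 * ?E)" by simp
  also have "\<dots> \<le> q * (real (card A) * D)" using q by (intro mult_left_mono lower) auto
  also have "\<dots> = real (card A) * (q * D)" by simp
  also have "\<dots> \<le> real (card A) * ((2 + 18 * r) * \<Delta>)" by (intro mult_left_mono upper) auto
  finally have m: "?m * ?E \<le> \<Delta> * (288 * (2 + 18 * r) * real (card A))" by (simp add: algebra_simps)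
  have "288 * (2 + 18 * r) * real (card A) > 0"
    using A r by (intro mult_pos_pos) (auto simp: card_gt_0_iff)
  then have "?m / (288 * (2 + 18 * r) * real (card A)) * ?E \<le> \<Delta>"
    using m by (simp add: divide_le_eq)
  with decay show ?thesis by (simp add: algebra_simps)
qed

text \<open>Iterates the block estimate with \<open>1 - c <= exp (- c)\<close>. The same
  \<open>q\<close> serves every block, so one block length works throughout.\<close>

lemma energy_averaging_blocks:
  fixes f :: "nat \<Rightarrow> 'b \<Rightarrow> complex"
  assumes A: "finite A" "A \<noteq> {}" and u: "\<And>y. y \<in> A \<Longrightarrow> cmod (u y) = 1"
    and step: "\<And>k y. k < N * B \<Longrightarrow> y \<in> A \<Longrightarrow>
      f (Suc k) y = u y * (of_real (1 - p k) * f k y + of_real (p k) * mean A (f k))"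
    and p: "\<And>k. k < N * B \<Longrightarrow> q \<le> p k" "\<And>k. k < N * B \<Longrightarrow> p k \<le> r * q"
      "\<And>k. k < N * B \<Longrightarrow> p k \<le> 1"
    and q: "q > 0" and r: "r \<ge> 1" and B: "B \<ge> 2" "2 \<le> q * real B" "q * real B \<le> 3"
    and sep: "\<And>y. y \<in> A \<Longrightarrow> \<exists>z\<in>A. cmod (u y - u z) \<ge> \<sigma>" and \<sigma>: "\<sigma> \<ge> 0"
  shows "energy A (f (N * B))
    \<le> exp (- (real N * ((min 1 (real B * \<sigma>))\<^sup>2 / (288 * (2 + 18 * r) * real (card A))))) * energy A (f 0)"
  using step p
proof (induction N)
  case (Suc N)
  define c where "c = (min 1 (real B * \<sigma>))\<^sup>2 / (288 * (2 + 18 * r) * real (card A))"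
  have lt: "N * B + k < Suc N * B" if "k < B" for k using that by simp
  have IH: "energy A (f (N * B)) \<le> exp (- (real N * c)) * energy A (f 0)"
    unfolding c_def by (rule Suc.IH) (use Suc.prems in auto)
  have "energy A (f (N * B + B)) \<le> (1 - c) * energy A (f (N * B + 0))"
    unfolding c_def
    by (rule energy_averaging_block[where f="\<lambda>k. f (N * B + k)" and u=u and p="\<lambda>k. p (N * B + k)" and q=q])
      (use Suc.prems lt A u q r B sep \<sigma> in auto)
  also have "\<dots> \<le> exp (- c) * energy A (f (N * B))"
    using exp_ge_add_one_self[of "- c"] by (intro mult_mono) (auto simp: energy_nonneg)
  also have "\<dots> \<le> exp (- c) * (exp (- (real N * c)) * energy A (f 0))"
    by (intro mult_left_mono IH) auto
  also have "\<dots> = exp (- (real (Suc N) * c)) * energy A (f 0)"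
    by (simp add: exp_add exp_diff exp_minus field_simps)
  finally show ?case unfolding c_def by (simp add: add.commute)
qed simp

subsection \<open>Fourier averages over a grid\<close>

lemma inverse_one_minus_exp_le:
  assumes "t > (0::real)"
  shows "1 / (1 - exp (- t)) \<le> 1 + 1 / t"
proof -
  have "exp (- t) \<le> 1 / (1 + t)"
    using exp_ge_add_one_self[of t] assms by (simp add: exp_minus field_simps)
  then have "1 - exp (- t) \<ge> t / (1 + t)" using assms by (simp add: field_simps)
  then have "1 / (1 - exp (- t)) \<le> 1 / (t / (1 + t))"
    using assms by (intro divide_left_mono mult_pos_pos) auto
  then show ?thesis using assms by (simp add: field_simps)
qed

lemma sum_gaussian_le:
  assumes a: "a > (0::real)"
  shows "(\<Sum>j<M. exp (- a * (real j)\<^sup>2)) \<le> exp 1 * (1 + 1 / (2 * sqrt a))"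
proof -
  let ?x = "sqrt a"
  let ?z = "exp (- (2 * ?x))"
  have x: "?x > 0" "?x\<^sup>2 = a" using a by auto
  have "(\<Sum>j<M. exp (- a * (real j)\<^sup>2)) \<le> (\<Sum>j<M. exp 1 * ?z ^ j)"
  proof (intro sum_mono)
    fix j
    \<comment> \<open>\<open>a j\<^sup>2 \<ge> 2 sqrt a j - 1\<close> reduces the sum to a geometric series.\<close>
    have "0 \<le> (?x * real j - 1)\<^sup>2" by simp
    also have "(?x * real j - 1)\<^sup>2 = a * (real j)\<^sup>2 - 2 * ?x * real j + 1"
      using x(2) by (simp add: power2_eq_square algebra_simps)
    finally have "- a * (real j)\<^sup>2 \<le> 1 + real j * (- (2 * ?x))" by (simp add: algebra_simps)
    then have "exp (- a * (real j)\<^sup>2) \<le> exp (1 + real j * (- (2 * ?x)))" by simp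
    also have "\<dots> = exp 1 * ?z ^ j" by (simp only: exp_add exp_of_nat_mult)
    finally show "exp (- a * (real j)\<^sup>2) \<le> exp 1 * ?z ^ j" .
  qed
  also have "\<dots> = exp 1 * (\<Sum>j<M. ?z ^ j)" by (simp add: sum_distrib_left)
  also have "(\<Sum>j<M. ?z ^ j) \<le> 1 / (1 - ?z)"
    using x by (subst sum_gp_strict) (auto intro!: divide_right_mono)
  also have "\<dots> \<le> 1 + 1 / (2 * ?x)" using x by (intro inverse_one_minus_exp_le) auto
  finally show ?thesis by simp
qed

text \<open>The sine is symmetric about pi/2, so points past the middle are reflected to
  \<open>M - j\<close>. On the first half \<open>sin (pi * i / M) >= i / M\<close>, which leaves two
  Gaussian sums with \<open>a = \<kappa> / M^2\<close>.\<close>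

lemma sum_exp_sin_squared_le:
  assumes k: "\<kappa> > (0::real)" and M: "M \<ge> (1::nat)"
  shows "(\<Sum>j<M. exp (- \<kappa> * (sin (pi * real j / real M))\<^sup>2)) \<le> 2 * exp 1 * (1 + real M / (2 * sqrt \<kappa>))"
proof -
  define a where "a = \<kappa> / (real M)\<^sup>2"
  have a: "a > 0" using k M by (simp add: a_def)
  have key: "exp (- \<kappa> * (sin (pi * real i / real M))\<^sup>2) \<le> exp (- a * (real i)\<^sup>2)" if "2 * i \<le> M" for i
  proof -
    have "pi * real i / real M \<le> pi / 2" using that M by (simp add: field_simps)
    then have "pi * real i / real M / 2 \<le> sin (pi * real i / real M)" by (intro half_le_sin) auto
    moreover have "2 * real i \<le> pi * real i" using pi_gt3 by (intro mult_right_mono) auto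
    then have "real i / real M \<le> pi * real i / real M / 2" using M by (simp add: field_simps)
    ultimately have "(real i / real M)\<^sup>2 \<le> (sin (pi * real i / real M))\<^sup>2" by (intro power_mono) auto
    then have "\<kappa> * (real i / real M)\<^sup>2 \<le> \<kappa> * (sin (pi * real i / real M))\<^sup>2"
      using k by (intro mult_left_mono) auto
    then show ?thesis by (simp add: a_def power_divide)
  qed
  have "(\<Sum>j<M. exp (- \<kappa> * (sin (pi * real j / real M))\<^sup>2))
      \<le> (\<Sum>j<M. exp (- a * (real j)\<^sup>2) + exp (- a * (real (M - j))\<^sup>2))"
  proof (intro sum_mono)
    fix j assume "j \<in> {..<M}"
    then have j: "j < M" by simp
    show "exp (- \<kappa> * (sin (pi * real j / real M))\<^sup>2) \<le> exp (- a * (real j)\<^sup>2) + exp (- a * (real (M - j))\<^sup>2)"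
    proof (cases "2 * j \<le> M")
      case True
      from key[OF this] show ?thesis by (simp add: add_increasing2)
    next
      case False
      have "sin (pi * real (M - j) / real M) = sin (pi - pi * real j / real M)"
        using j by (simp add: of_nat_diff field_simps)
      then have "sin (pi * real (M - j) / real M) = sin (pi * real j / real M)" by simp
      with key[of "M - j"] False show ?thesis by (simp add: add_increasing)
    qed
  qed
  also have "\<dots> = (\<Sum>j<M. exp (- a * (real j)\<^sup>2)) + (\<Sum>j<M. exp (- a * (real (M - j))\<^sup>2))"
    by (rule sum.distrib)
  \<comment> \<open>Passing to \<open>M - Suc j\<close> only enlarges the terms, and makes the sum
    an exact reversal of the first one.\<close>
  also have "(\<Sum>j<M. exp (- a * (real (M - j))\<^sup>2)) \<le> (\<Sum>j<M. exp (- a * (real (M - Suc j))\<^sup>2))"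
    using a by (intro sum_mono) (auto intro!: power_mono)
  also have "\<dots> = (\<Sum>j<M. exp (- a * (real j)\<^sup>2))"
    by (rule sum.nat_diff_reindex)
  also have "(\<Sum>j<M. exp (- a * (real j)\<^sup>2)) + (\<Sum>j<M. exp (- a * (real j)\<^sup>2))
      \<le> 2 * (exp 1 * (1 + 1 / (2 * sqrt a)))"
    using sum_gaussian_le[OF a, of M] by simp
  also have "\<dots> = 2 * exp 1 * (1 + real M / (2 * sqrt \<kappa>))"
    using M by (simp add: a_def real_sqrt_divide)
  finally show ?thesis by simp
qed

text \<open>The squared sine has period pi, so an even grid of \<open>2 * M\<close> points runs
  through the grid of the preceding lemma twice. The condition \<open>sqrt \<kappa> <= M\<close>
  absorbs \<open>2 / M\<close> into \<open>2 / sqrt \<kappa>\<close>, and \<open>exp 1 <= 3\<close>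
  then gives 9.\<close>

lemma grid_average_exp_sin_squared_le:
  assumes k: "\<kappa> > (0::real)" and M: "M \<ge> (1::nat)" "sqrt \<kappa> \<le> real M"
  shows "(\<Sum>j<2 * M. exp (- \<kappa> * (sin (2 * pi * real j / real (2 * M)))\<^sup>2)) / real (2 * M) \<le> 9 / sqrt \<kappa>"
proof -
  define g where "g j = exp (- \<kappa> * (sin (pi * real j / real M))\<^sup>2)" for j
  have per: "g (j + M) = g j" for j
  proof -
    have "pi * real (j + M) / real M = pi * real j / real M + pi" using M by (simp add: field_simps)
    then show ?thesis by (simp add: g_def)
  qed
  have "(\<Sum>j<2 * M. exp (- \<kappa> * (sin (2 * pi * real j / real (2 * M)))\<^sup>2)) = (\<Sum>j<2 * M. g j)"
    by (simp add: g_def mult.assoc)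
  also have "\<dots> = (\<Sum>i<2. sum g {i * M..<i * M + M})" by (rule sum.nat_group[symmetric])
  also have "\<dots> = sum g {0..<M} + sum g {0 + M..<M + M}" by (simp add: eval_nat_numeral)
  also have "sum g {0 + M..<M + M} = sum g {0..<M}"
    unfolding sum.shift_bounds_nat_ivl by (simp add: per)
  finally have "(\<Sum>j<2 * M. exp (- \<kappa> * (sin (2 * pi * real j / real (2 * M)))\<^sup>2)) = 2 * sum g {..<M}"
    by (simp add: atLeast0LessThan)
  also have "\<dots> \<le> 2 * (2 * exp 1 * (1 + real M / (2 * sqrt \<kappa>)))"
    using sum_exp_sin_squared_le[OF k M(1)] by (simp add: g_def)
  finally have "(\<Sum>j<2 * M. exp (- \<kappa> * (sin (2 * pi * real j / real (2 * M)))\<^sup>2)) / real (2 * M)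
      \<le> 2 * (2 * exp 1 * (1 + real M / (2 * sqrt \<kappa>))) / real (2 * M)"
    by (intro divide_right_mono) auto
  also have "\<dots> = exp 1 * (2 / real M + 1 / sqrt \<kappa>)" using M k by (simp add: field_simps)
  also have "\<dots> \<le> 3 * (2 / sqrt \<kappa> + 1 / sqrt \<kappa>)"
    using M k exp_le by (intro mult_mono add_mono divide_left_mono mult_pos_pos) auto
  finally show ?thesis by simp
qed

text \<open>The sum is geometric in an \<open>m\<close>-th root of unity, and \<open>b\<close> is
  the indicator that \<open>m\<close> divides \<open>t\<close>.\<close>

lemma sum_roots_of_unity:
  assumes m: "m \<ge> (1::nat)" and t: "t \<in> \<int>"
  obtains b where "b \<in> {0, 1::real}" "t = 0 \<Longrightarrow> b = 1"
    "(\<Sum>j<m. cis (2 * pi * real j / real m * t)) = of_real (real m * b)"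
proof -
  define z where "z = cis (2 * pi / real m * t)"
  have s: "(\<Sum>j<m. cis (2 * pi * real j / real m * t)) = (\<Sum>j<m. z ^ j)"
    unfolding z_def Complex.DeMoivre by (simp add: algebra_simps)
  have "z ^ m = cis (2 * pi * t)"
    unfolding z_def Complex.DeMoivre using m by (simp add: field_simps)
  then have zm: "z ^ m = 1" using t cis_multiple_2pi by auto
  show thesis
  proof (cases "z = 1")
    case True
    then show thesis using that[of 1] s by simp
  next
    case False
    then have "t \<noteq> 0" by (auto simp: z_def)
    then show thesis using that[of 0] s False zm by (simp add: sum_gp_strict)
  qed
qed

abbreviation frequency :: "nat \<Rightarrow> ('d \<Rightarrow> nat) \<Rightarrow> real ^ 'd::finite" where
  "frequency m g \<equiv> (\<chi> i. 2 * pi * real (g i) / real m)"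

lemma cis_sum: "cis (\<Sum>i\<in>I. f i) = (\<Prod>i\<in>I. cis (f i))"
  by (induction I rule: infinite_finite_induct) (auto simp: cis_mult[symmetric])

lemma sum_frequency_cis:
  fixes v :: "real ^ 'd::finite"
  assumes m: "m \<ge> 1" and v: "\<And>i. v $ i \<in> \<int>"
  obtains b where "b \<ge> 0" "v = 0 \<Longrightarrow> b = 1"
    "(\<Sum>g\<in>PiE UNIV (\<lambda>_. {..<m}). cis (frequency m g \<bullet> v)) = of_real (real (m ^ CARD('d)) * b)"
proof -
  have "\<forall>i. \<exists>b. b \<in> {0, 1::real} \<and> (v $ i = 0 \<longrightarrow> b = 1) \<and>
      (\<Sum>j<m. cis (2 * pi * real j / real m * v $ i)) = of_real (real m * b)"
    using sum_roots_of_unity[OF m v] by metis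
  then obtain b where b: "\<And>i. b i \<in> {0, 1::real}" "\<And>i. v $ i = 0 \<Longrightarrow> b i = 1"
    "\<And>i. (\<Sum>j<m. cis (2 * pi * real j / real m * v $ i)) = of_real (real m * b i)"
    by metis
  have "(\<Sum>g\<in>PiE UNIV (\<lambda>_. {..<m}). cis (frequency m g \<bullet> v))
      = (\<Sum>g\<in>PiE UNIV (\<lambda>_. {..<m}). \<Prod>i\<in>UNIV. cis (2 * pi * real (g i) / real m * v $ i))"
    by (simp add: inner_vec_def cis_sum)
  also have "\<dots> = (\<Prod>i\<in>UNIV. \<Sum>j<m. cis (2 * pi * real j / real m * v $ i))"
    by (subst prod_sum_PiE) auto
  also have "\<dots> = of_real (real (m ^ CARD('d)) * (\<Prod>i\<in>UNIV. b i))"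
    unfolding b(3) by (simp add: prod.distrib)
  finally have "(\<Sum>g\<in>PiE UNIV (\<lambda>_. {..<m}). cis (frequency m g \<bullet> v))
    = of_real (real (m ^ CARD('d)) * (\<Prod>i\<in>UNIV. b i))" .
  moreover have "(\<Prod>i\<in>UNIV. b i) \<ge> 0" using b(1) by (intro prod_nonneg) (metis insertE order_refl singletonD zero_le_one)
  moreover have "(\<Prod>i\<in>UNIV. b i) = 1" if "v = 0" using b(2) that by simp
  ultimately show thesis using that by blast
qed

text \<open>Fourier inversion on a finite grid in place of an integral over the torus. The grid
  cannot tell \<open>w\<close> from sites congruent to it modulo \<open>m\<close> in every
  coordinate, but these enter with nonnegative weight, so an upper bound survives for every
  \<open>m >= 1\<close>.\<close>

lemma point_mass_le_fourier_average:
  fixes s :: "'h \<Rightarrow> real ^ 'd::finite"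
  assumes m: "m \<ge> 1" and H: "finite H" and W: "\<And>h. h \<in> H \<Longrightarrow> W h \<ge> 0"
    and s: "\<And>h. h \<in> H \<Longrightarrow> s h \<in> integer_lattice" and w: "w \<in> integer_lattice"
  shows "(\<Sum>h\<in>{h\<in>H. s h = w}. W h) \<le>
    (\<Sum>g\<in>PiE UNIV (\<lambda>_. {..<m}). cmod (\<Sum>h\<in>H. of_real (W h) * cis (frequency m g \<bullet> s h)))
      / real (m ^ CARD('d))"
proof -
  let ?G = "PiE UNIV (\<lambda>_::'d. {..<m})"
  have "\<forall>h\<in>H. \<exists>b. b \<ge> 0 \<and> (s h = w \<longrightarrow> b = 1) \<and>
    (\<Sum>g\<in>?G. cis (frequency m g \<bullet> (s h - w))) = of_real (real (m ^ CARD('d)) * b)"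
  proof
    fix h assume "h \<in> H"
    then have "(s h - w) $ i \<in> \<int>" for i using s w by (auto simp: integer_lattice_def)
    from sum_frequency_cis[OF m this] show "\<exists>b. b \<ge> 0 \<and> (s h = w \<longrightarrow> b = 1) \<and>
      (\<Sum>g\<in>?G. cis (frequency m g \<bullet> (s h - w))) = of_real (real (m ^ CARD('d)) * b)"
      by (metis right_minus_eq)
  qed
  then obtain b where b: "\<And>h. h \<in> H \<Longrightarrow> b h \<ge> 0" "\<And>h. h \<in> H \<Longrightarrow> s h = w \<Longrightarrow> b h = 1"
    "\<And>h. h \<in> H \<Longrightarrow> (\<Sum>g\<in>?G. cis (frequency m g \<bullet> (s h - w))) = of_real (real (m ^ CARD('d)) * b h)"
    by metis
  have "(\<Sum>h\<in>{h\<in>H. s h = w}. W h) = (\<Sum>h\<in>{h\<in>H. s h = w}. W h * b h)"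
    using b(2) by (intro sum.cong) auto
  also have "\<dots> \<le> (\<Sum>h\<in>H. W h * b h)"
    using H W b(1) by (intro sum_mono2) auto
  finally have "real (m ^ CARD('d)) * (\<Sum>h\<in>{h\<in>H. s h = w}. W h)
      \<le> real (m ^ CARD('d)) * (\<Sum>h\<in>H. W h * b h)"
    by (intro mult_left_mono) auto
  also have "\<dots> \<le> cmod (of_real (real (m ^ CARD('d)) * (\<Sum>h\<in>H. W h * b h)))"
    unfolding norm_of_real by simp
  also have "of_real (real (m ^ CARD('d)) * (\<Sum>h\<in>H. W h * b h))
      = (\<Sum>h\<in>H. of_real (W h) * of_real (real (m ^ CARD('d)) * b h))"
    by (simp add: sum_distrib_left algebra_simps)
  also have "\<dots> = (\<Sum>h\<in>H. of_real (W h) * (\<Sum>g\<in>?G. cis (frequency m g \<bullet> (s h - w))))"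
    by (intro sum.cong) (simp_all only: b(3))
  also have "\<dots> = (\<Sum>g\<in>?G. cis (- (frequency m g \<bullet> w)) * (\<Sum>h\<in>H. of_real (W h) * cis (frequency m g \<bullet> s h)))"
    unfolding sum_distrib_left
    by (subst sum.swap) (simp add: inner_diff_right cis_mult algebra_simps)
  also have "cmod \<dots> \<le> (\<Sum>g\<in>?G. cmod (\<Sum>h\<in>H. of_real (W h) * cis (frequency m g \<bullet> s h)))"
    by (rule order_trans[OF norm_sum]) (simp add: norm_mult)
  finally show ?thesis using m by (simp add: field_simps)
qed

subsection \<open>The characteristic function of the walk\<close>

lemma finite_steps: "finite (steps :: (real ^ 'd::finite) set)"
  by (simp add: steps_def)

lemma axis_in_steps: "axis i 1 \<in> steps" "- axis i 1 \<in> steps"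
  by (auto simp: steps_def)

lemma steps_nonempty: "(steps :: (real ^ 'd::finite) set) \<noteq> {}"
  using axis_in_steps by blast

lemma card_steps: "card (steps :: (real ^ 'd::finite) set) = 2 * CARD('d)"
proof -
  let ?P = "range (\<lambda>i::'d. axis i 1 :: real ^ 'd)" and ?N = "range (\<lambda>i::'d. - axis i 1 :: real ^ 'd)"
  have "axis i 1 \<noteq> (- axis j 1 :: real ^ 'd)" for i j
  proof
    assume "axis i 1 = (- axis j 1 :: real ^ 'd)"
    then have "(axis i 1 :: real ^ 'd) $ i = (- axis j 1 :: real ^ 'd) $ i" by simp
    then show False by (simp add: axis_def split: if_splits)
  qed
  then have "?P \<inter> ?N = {}" by auto
  moreover have "card ?P = CARD('d)" "card ?N = CARD('d)"
    by (auto intro!: card_image simp: inj_on_def axis_eq_axis)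
  ultimately show ?thesis by (simp add: steps_def card_Un_disjoint)
qed

lemma steps_subset_integer_lattice: "steps \<subseteq> integer_lattice"
  by (auto simp: steps_def integer_lattice_def axis_def)

lemma sum_in_integer_lattice:
  assumes "\<And>k. k \<in> I \<Longrightarrow> v k \<in> integer_lattice"
  shows "(\<Sum>k\<in>I. v k) \<in> integer_lattice"
  using assms by (auto simp: integer_lattice_def intro!: Ints_sum)

section \<open>Finite sets of trajectories\<close>

abbreviation paths :: "nat \<Rightarrow> (nat \<Rightarrow> real ^ 'd::finite) set" where
  "paths n \<equiv> PiE {1..n} (\<lambda>_. steps)"

lemma finite_paths: "finite (paths n)"
  by (simp add: finite_PiE finite_steps)

lemma sum_paths_Suc:
  "(\<Sum>h\<in>paths (Suc n). F h) = (\<Sum>z\<in>steps. \<Sum>h\<in>paths n. F (h(Suc n := z)))"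
proof -
  have "{1..Suc n} = insert (Suc n) {1..n}" by auto
  then have "(\<Sum>h\<in>paths (Suc n). F h) = (\<Sum>h\<in>(\<lambda>(z, h). h(Suc n := z)) ` (steps \<times> paths n). F h)"
    by (simp add: PiE_insert_eq)
  also have "\<dots> = (\<Sum>(z, h)\<in>steps \<times> paths n. F (h(Suc n := z)))"
    by (subst sum.reindex[OF inj_combinator]) (auto simp: case_prod_unfold)
  also have "\<dots> = (\<Sum>z\<in>steps. \<Sum>h\<in>paths n. F (h(Suc n := z)))"
    by (rule sum.cartesian_product[symmetric])
  finally show ?thesis .
qed

context conservative_random_walk
begin

section \<open>Trajectory probabilities and the recursion for the characteristic function\<close>

definition path_prob :: "nat \<Rightarrow> (nat \<Rightarrow> real ^ 'd) \<Rightarrow> real" where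
  "path_prob n h = \<P>(\<omega> in M. \<forall>k\<in>{1..n}. Y k \<omega> = h k)"

lemma step_in_steps: "k \<ge> 1 \<Longrightarrow> \<omega> \<in> space M \<Longrightarrow> Y k \<omega> \<in> steps"
  using measurable_space[OF step_measurable] by fastforce

lemma step_event: "k \<ge> 1 \<Longrightarrow> {\<omega> \<in> space M. Y k \<omega> = y} \<in> events"
proof -
  assume k: "k \<ge> 1"
  have "{\<omega> \<in> space M. Y k \<omega> = y} = Y k -` ({y} \<inter> steps) \<inter> space M"
    using step_in_steps[OF k] by auto
  also have "\<dots> \<in> events" by (rule measurable_sets[OF step_measurable[OF k]]) simp
  finally show ?thesis .
qed

lemma path_event: "{\<omega> \<in> space M. \<forall>k\<in>{1..n}. Y k \<omega> = h k} \<in> events"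
  using step_event by (intro sets.sets_Collect_finite_All) auto

lemma path_prob_cong: "(\<And>k. k \<in> {1..n} \<Longrightarrow> h k = h' k) \<Longrightarrow> path_prob n h = path_prob n h'"
  unfolding path_prob_def by (intro arg_cong[where f=prob]) auto

lemma path_prob_nonneg: "path_prob n h \<ge> 0"
  by (simp add: path_prob_def)

text \<open>The assumption \<open>markov\<close> covers only trajectories of positive probability.
  For a null trajectory both sides vanish, since extending it shrinks the event.\<close>

lemma path_prob_Suc:
  assumes n: "n \<ge> 1" and h: "\<And>k. k \<in> {1..Suc n} \<Longrightarrow> h k \<in> steps"
  shows "path_prob (Suc n) h = path_prob n h * transition p n (h n) (h (Suc n))"
proof (cases "path_prob n h = 0")
  case True
  have "path_prob (Suc n) h \<le> path_prob n h"
    unfolding path_prob_def by (intro finite_measure_mono path_event) auto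
  with True show ?thesis using path_prob_nonneg[of "Suc n" h] by simp
next
  case False
  then have pos: "path_prob n h > 0" using path_prob_nonneg[of n h] by simp
  have "path_prob (Suc n) h = \<P>(\<omega> in M. Y (Suc n) \<omega> = h (Suc n) \<and> (\<forall>k\<in>{1..n}. Y k \<omega> = h k))"
    unfolding path_prob_def by (intro arg_cong[where f=prob]) (auto simp: atLeastAtMostSuc_conv)
  with markov[OF n h] pos show ?thesis
    by (simp add: cond_prob_def path_prob_def field_simps)
qed

text \<open>This finite union yields measurability and turns point probabilities of the walk into
  finite sums of path weights.\<close>

lemma walk_event_eq: "{\<omega> \<in> space M. walk Y n \<omega> = w}
    = (\<Union>h\<in>{h \<in> paths n. (\<Sum>k=1..n. h k) = w}. {\<omega> \<in> space M. \<forall>k\<in>{1..n}. Y k \<omega> = h k})"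
  (is "_ = (\<Union>h\<in>?H. ?E h)")
proof (intro equalityI subsetI)
  fix \<omega> assume \<omega>: "\<omega> \<in> {\<omega> \<in> space M. walk Y n \<omega> = w}"
  have "restrict (\<lambda>k. Y k \<omega>) {1..n} \<in> ?H"
    using \<omega> step_in_steps by (auto simp: walk_def)
  moreover have "\<omega> \<in> ?E (restrict (\<lambda>k. Y k \<omega>) {1..n})" using \<omega> by simp
  ultimately show "\<omega> \<in> (\<Union>h\<in>?H. ?E h)" by blast
qed (auto simp: walk_def)

lemma walk_event: "{\<omega> \<in> space M. walk Y n \<omega> = w} \<in> events"
  unfolding walk_event_eq
  by (intro sets.finite_UN finite_subset[OF _ finite_paths[of n]] path_event) auto

lemma prob_walk_eq: "\<P>(\<omega> in M. walk Y n \<omega> = w)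
    = (\<Sum>h\<in>{h \<in> paths n. (\<Sum>k=1..n. h k) = w}. path_prob n h)"
proof -
  let ?H = "{h \<in> paths n. (\<Sum>k=1..n. h k) = w}"
  let ?E = "\<lambda>h. {\<omega> \<in> space M. \<forall>k\<in>{1..n}. Y k \<omega> = h k}"
  have "disjoint_family_on ?E ?H"
    unfolding disjoint_family_on_def
  proof (intro ballI impI)
    fix h h' assume "h \<in> ?H" "h' \<in> ?H" "h \<noteq> h'"
    then obtain k where "k \<in> {1..n}" "h k \<noteq> h' k"
      by (metis (mono_tags, lifting) PiE_ext mem_Collect_eq)
    then show "?E h \<inter> ?E h' = {}" by auto
  qed
  then have "prob (\<Union>h\<in>?H. ?E h) = (\<Sum>h\<in>?H. prob (?E h))"
    using finite_subset[of ?H, OF _ finite_paths[of n]] path_event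
    by (intro finite_measure_finite_Union image_subsetI) auto
  then show ?thesis by (simp only: walk_event_eq path_prob_def)
qed

text \<open>The expectation of \<open>exp (i \<theta> \<bullet> S\<^sub>n)\<close> on the event \<open>Y\<^sub>n = y\<close>.\<close>

definition partial_char :: "real ^ 'd \<Rightarrow> nat \<Rightarrow> real ^ 'd \<Rightarrow> complex" where
  "partial_char \<theta> n y = (\<Sum>h\<in>paths n. if h n = y
     then of_real (path_prob n h) * cis (\<theta> \<bullet> (\<Sum>k=1..n. h k)) else 0)"

lemma sum_partial_char:
  assumes "n \<ge> 1"
  shows "(\<Sum>y\<in>steps. partial_char \<theta> n y) = (\<Sum>h\<in>paths n. of_real (path_prob n h) * cis (\<theta> \<bullet> (\<Sum>k=1..n. h k)))"
proof -
  have "(\<Sum>y\<in>steps. partial_char \<theta> n y) = (\<Sum>h\<in>paths n. \<Sum>y\<in>steps. if h n = y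
     then of_real (path_prob n h) * cis (\<theta> \<bullet> (\<Sum>k=1..n. h k)) else 0)"
    unfolding partial_char_def by (rule sum.swap)
  also have "\<dots> = (\<Sum>h\<in>paths n. of_real (path_prob n h) * cis (\<theta> \<bullet> (\<Sum>k=1..n. h k)))"
  proof (intro sum.cong refl)
    fix h :: "nat \<Rightarrow> real ^ 'd" assume "h \<in> paths n"
    then have "h n \<in> steps" using assms by auto
    then show "(\<Sum>y\<in>steps. if h n = y then of_real (path_prob n h) * cis (\<theta> \<bullet> (\<Sum>k=1..n. h k)) else 0)
      = of_real (path_prob n h) * cis (\<theta> \<bullet> (\<Sum>k=1..n. h k))"
      by (simp add: finite_steps)
  qed
  finally show ?thesis .
qed

text \<open>Allowing \<open>n = 0\<close> makes the initial values an instance of the same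
  splitting.\<close>

lemma partial_char_Suc_eq:
  assumes "z \<in> steps"
  shows "partial_char \<theta> (Suc n) z
    = (\<Sum>h\<in>paths n. of_real (path_prob (Suc n) (h(Suc n := z))) * cis (\<theta> \<bullet> (\<Sum>k=1..n. h k)) * cis (\<theta> \<bullet> z))"
proof -
  have "partial_char \<theta> (Suc n) z = (\<Sum>x\<in>steps. if x = z then
      (\<Sum>h\<in>paths n. of_real (path_prob (Suc n) (h(Suc n := x))) * cis (\<theta> \<bullet> (\<Sum>k=1..Suc n. (h(Suc n := x)) k))) else 0)"
    unfolding partial_char_def sum_paths_Suc by (intro sum.cong refl) simp
  also have "\<dots> = (\<Sum>h\<in>paths n. of_real (path_prob (Suc n) (h(Suc n := z))) * cis (\<theta> \<bullet> (\<Sum>k=1..Suc n. (h(Suc n := z)) k)))"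
    using assms by (simp add: finite_steps)
  also have "\<dots> = (\<Sum>h\<in>paths n. of_real (path_prob (Suc n) (h(Suc n := z))) * cis (\<theta> \<bullet> (\<Sum>k=1..n. h k)) * cis (\<theta> \<bullet> z))"
  proof (intro sum.cong refl)
    fix h :: "nat \<Rightarrow> real ^ 'd"
    have "(\<Sum>k=1..Suc n. (h(Suc n := z)) k) = (\<Sum>k=1..n. h k) + z" by (simp add: sum.cl_ivl_Suc)
    then show "of_real (path_prob (Suc n) (h(Suc n := z))) * cis (\<theta> \<bullet> (\<Sum>k=1..Suc n. (h(Suc n := z)) k))
      = of_real (path_prob (Suc n) (h(Suc n := z))) * cis (\<theta> \<bullet> (\<Sum>k=1..n. h k)) * cis (\<theta> \<bullet> z)"
      by (simp add: inner_add_right cis_mult[symmetric] mult.assoc)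
  qed
  finally show ?thesis .
qed

lemma partial_char_1:
  assumes "y \<in> steps"
  shows "partial_char \<theta> 1 y = cis (\<theta> \<bullet> y) / of_nat (2 * CARD('d))"
proof -
  have "path_prob (Suc 0) (h(Suc 0 := y)) = 1 / real (2 * CARD('d))" for h
    unfolding path_prob_def using initial[OF assms] by simp
  then show ?thesis using partial_char_Suc_eq[OF assms, of \<theta> 0] by simp
qed

text \<open>Repeating the last step requires \<open>h n = z\<close>, which gives the first term. A
  fresh direction ignores \<open>h n\<close>, so its term collects all paths, and division by
  \<open>2d\<close>, the number of steps, produces the mean.\<close>

lemma partial_char_Suc:
  assumes n: "n \<ge> 1" and z: "z \<in> steps"
  shows "partial_char \<theta> (Suc n) z = cis (\<theta> \<bullet> z) *
    (of_real (1 - p n) * partial_char \<theta> n z + of_real (p n) * mean steps (partial_char \<theta> n))"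
proof -
  let ?c = "\<lambda>h. of_real (path_prob n h) * cis (\<theta> \<bullet> (\<Sum>k=1..n. h k))"
  have "partial_char \<theta> (Suc n) z = (\<Sum>h\<in>paths n. cis (\<theta> \<bullet> z) *
      (of_real (1 - p n) * (if h n = z then ?c h else 0) + of_real (p n) * (?c h / of_nat (2 * CARD('d)))))"
    unfolding partial_char_Suc_eq[OF z]
  proof (intro sum.cong refl)
    fix h :: "nat \<Rightarrow> real ^ 'd" assume h: "h \<in> paths n"
    have "path_prob (Suc n) (h(Suc n := z)) = path_prob n (h(Suc n := z)) * transition p n (h n) z"
      using h z n by (subst path_prob_Suc) auto
    also have "path_prob n (h(Suc n := z)) = path_prob n h" by (rule path_prob_cong) auto
    finally have "path_prob (Suc n) (h(Suc n := z)) = path_prob n h * transition p n (h n) z" .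
    then show "of_real (path_prob (Suc n) (h(Suc n := z))) * cis (\<theta> \<bullet> (\<Sum>k=1..n. h k)) * cis (\<theta> \<bullet> z)
      = cis (\<theta> \<bullet> z) * (of_real (1 - p n) * (if h n = z then ?c h else 0) + of_real (p n) * (?c h / of_nat (2 * CARD('d))))"
      unfolding transition_def by (simp only:) (simp add: algebra_simps)
  qed
  also have "\<dots> = cis (\<theta> \<bullet> z) * (of_real (1 - p n) * partial_char \<theta> n z
      + of_real (p n) * ((\<Sum>h\<in>paths n. ?c h) / of_nat (2 * CARD('d))))"
    by (simp add: sum_distrib_left[symmetric] sum.distrib sum_divide_distrib[symmetric] partial_char_def
        del: sum.cl_ivl_Suc)
  also have "(\<Sum>h\<in>paths n. ?c h) / of_nat (2 * CARD('d)) = mean steps (partial_char \<theta> n)"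
    by (simp only: mean_def sum_partial_char[OF n] card_steps)
  finally show ?thesis .
qed

text \<open>The steps \<open>axis i 1\<close> and \<open>- axis i 1\<close> have phases at distance
  \<open>2 * \<bar>sin (\<theta> $ i)\<bar>\<close>, so any third point is at least half that far
  from one of them.\<close>

lemma step_phases_separated:
  fixes \<theta> :: "real ^ 'd"
  shows "\<exists>z\<in>steps. cmod (cis (\<theta> \<bullet> y) - cis (\<theta> \<bullet> z)) \<ge> \<bar>sin (\<theta> $ i)\<bar>"
proof -
  let ?a = "cis (\<theta> $ i)" and ?b = "cis (- (\<theta> $ i))" and ?u = "cis (\<theta> \<bullet> y)"
  have "?a - ?b = of_real (2 * sin (\<theta> $ i)) * \<i>" by (simp add: complex_eq_iff)
  then have "cmod (?a - ?b) = 2 * \<bar>sin (\<theta> $ i)\<bar>"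
    by (simp only: norm_mult norm_of_real norm_ii abs_mult)
  moreover have "cmod (?a - ?b) \<le> cmod (?u - ?a) + cmod (?u - ?b)"
    using dist_triangle3[of ?a ?b ?u] by (simp add: dist_norm)
  ultimately have "cmod (?u - ?a) \<ge> \<bar>sin (\<theta> $ i)\<bar> \<or> cmod (?u - ?b) \<ge> \<bar>sin (\<theta> $ i)\<bar>" by linarith
  moreover have "\<theta> \<bullet> axis i 1 = \<theta> $ i" "\<theta> \<bullet> (- axis i 1) = - (\<theta> $ i)" by (simp_all add: inner_axis)
  ultimately show ?thesis using axis_in_steps[of i] by metis
qed

section \<open>Decay of the characteristic function and point probabilities\<close>

lemma energy_partial_char_1: "energy steps (partial_char \<theta> 1) = 1 / real (2 * CARD('d))"
proof -
  have "energy steps (partial_char \<theta> 1) = (\<Sum>y\<in>(steps :: (real ^ 'd) set). (1 / real (2 * CARD('d)))\<^sup>2)"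
    unfolding energy_def by (intro sum.cong refl, subst partial_char_1) (simp_all add: norm_divide norm_mult)
  then show ?thesis by (simp add: card_steps power2_eq_square field_simps)
qed

lemma energy_partial_char_le:
  assumes p: "\<And>k. k \<ge> 1 \<Longrightarrow> p k \<in> {0..1}"
  shows "n \<ge> 1 \<Longrightarrow> energy steps (partial_char \<theta> n) \<le> 1 / real (2 * CARD('d))"
proof (induction n rule: nat_induct_at_least)
  case base
  then show ?case using energy_partial_char_1 by simp
next
  case (Suc n)
  have "energy steps (partial_char \<theta> (Suc n))
      \<le> energy steps (partial_char \<theta> n) - p n * deviation steps (partial_char \<theta> n)"
    by (rule energy_averaging_step[where u="\<lambda>y. cis (\<theta> \<bullet> y)"])
      (use p[of n] Suc in \<open>auto simp: finite_steps steps_nonempty partial_char_Suc\<close>)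
  also have "\<dots> \<le> energy steps (partial_char \<theta> n)"
    using p[of n] Suc by (simp add: deviation_nonneg)
  finally show ?case using Suc by simp
qed

text \<open>Contraction is applied to the last \<open>N * B\<close> steps; up to then the energy is
  at most \<open>1 / (2d)\<close>. The characteristic function is \<open>2d\<close> times the mean,
  so its squared modulus is at most \<open>2d\<close> times the energy. The square root halves the
  exponent, and 1152 = 2 * 2 * 288.\<close>

lemma char_walk_le:
  fixes \<theta> :: "real ^ 'd"
  assumes p: "\<And>k. k \<ge> 1 \<Longrightarrow> p k \<in> {0..1}"
    and n: "N * B < n"
    and window: "\<And>k. n - N * B \<le> k \<Longrightarrow> k < n \<Longrightarrow> q \<le> p k \<and> p k \<le> r * q"
    and q: "q > 0" and r: "r \<ge> 1" and B: "B \<ge> 2" "2 \<le> q * real B" "q * real B \<le> 3"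
  shows "cmod (\<Sum>h\<in>paths n. of_real (path_prob n h) * cis (\<theta> \<bullet> (\<Sum>k=1..n. h k)))
    \<le> exp (- (real N * (min 1 (real B * \<bar>sin (\<theta> $ i)\<bar>))\<^sup>2 / (1152 * (2 + 18 * r) * real CARD('d))))"
proof -
  \<comment> \<open>The transitions from time \<open>a\<close> to time \<open>n\<close> use
    \<open>p k\<close> for \<open>a <= k < n\<close>. Since \<open>N * B < n\<close>,
    \<open>a >= 1\<close>, where the recursion begins to hold.\<close>
  define a where "a = n - N * B"
  have a: "a \<ge> 1" "a + N * B = n" using n by (auto simp: a_def)
  define x where "x = real N * ((min 1 (real B * \<bar>sin (\<theta> $ i)\<bar>))\<^sup>2 / (288 * (2 + 18 * r) * real (2 * CARD('d))))"
  let ?f = "partial_char \<theta>" and ?S = "steps :: (real ^ 'd) set"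
  have "energy ?S (?f (a + N * B)) \<le> exp (- x) * energy ?S (?f (a + 0))"
    unfolding x_def card_steps[symmetric, where 'd='d]
  proof (rule energy_averaging_blocks[where f="\<lambda>k. ?f (a + k)" and p="\<lambda>k. p (a + k)" and u="\<lambda>y. cis (\<theta> \<bullet> y)" and q=q])
    show "?f (a + Suc k) y = cis (\<theta> \<bullet> y) *
        (of_real (1 - p (a + k)) * ?f (a + k) y + of_real (p (a + k)) * mean ?S (?f (a + k)))"
      if "y \<in> steps" for k y using a that by (simp add: partial_char_Suc)
    show "p (a + k) \<le> 1" for k using p[of "a + k"] a by simp
    show "q \<le> p (a + k)" "p (a + k) \<le> r * q" if "k < N * B" for k
      using window[of "a + k"] a that by (auto simp: a_def)
    show "\<exists>z\<in>?S. \<bar>sin (\<theta> $ i)\<bar> \<le> cmod (cis (\<theta> \<bullet> y) - cis (\<theta> \<bullet> z))" for y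
      by (rule step_phases_separated)
  qed (use finite_steps steps_nonempty q r B in auto)
  also have "\<dots> \<le> exp (- x) * (1 / real (2 * CARD('d)))"
    using energy_partial_char_le[OF p a(1)] by (intro mult_left_mono) auto
  finally have e: "energy ?S (?f n) \<le> exp (- x) / real (2 * CARD('d))" by (simp add: a)
  have "real (2 * CARD('d)) * (cmod (mean ?S (?f n)))\<^sup>2 \<le> energy ?S (?f n)"
    using energy_decomp[OF finite_steps steps_nonempty, of "?f n"] deviation_nonneg[of ?S "?f n"]
    by (simp add: card_steps)
  also note e
  finally have m: "(real (2 * CARD('d)) * cmod (mean ?S (?f n)))\<^sup>2 \<le> exp (- x)"
    by (simp add: field_simps power2_eq_square)
  have "n \<ge> 1" using a by linarith
  then have "(\<Sum>h\<in>paths n. of_real (path_prob n h) * cis (\<theta> \<bullet> (\<Sum>k=1..n. h k)))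
      = of_nat (2 * CARD('d)) * mean ?S (?f n)"
    by (simp add: mean_def sum_partial_char card_steps)
  then have "(cmod (\<Sum>h\<in>paths n. of_real (path_prob n h) * cis (\<theta> \<bullet> (\<Sum>k=1..n. h k))))\<^sup>2 \<le> exp (- x)"
    using m by (simp only: norm_mult norm_of_nat)
  also have "exp (- x) = (exp (- (x / 2)))\<^sup>2"
    by (simp add: power2_eq_square exp_add[symmetric])
  finally have "cmod (\<Sum>h\<in>paths n. of_real (path_prob n h) * cis (\<theta> \<bullet> (\<Sum>k=1..n. h k))) \<le> exp (- (x / 2))"
    by (rule power2_le_imp_le) simp
  then show ?thesis by (simp add: x_def algebra_simps)
qed

text \<open>At each frequency the coordinate with the largest sine is used. Either the contraction
  is saturated and gives \<open>exp (- c * N)\<close>, or the bound splits into a product over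
  coordinates, so that the grid average becomes a \<open>d\<close>-th power.\<close>

lemma prob_walk_le:
  assumes p: "\<And>k. k \<ge> 1 \<Longrightarrow> p k \<in> {0..1}"
    and n: "N * B < n" and N: "N \<ge> 1"
    and window: "\<And>k. n - N * B \<le> k \<Longrightarrow> k < n \<Longrightarrow> q \<le> p k \<and> p k \<le> r * q"
    and q: "q > 0" and r: "r \<ge> 1" and B: "B \<ge> 2" "2 \<le> q * real B" "q * real B \<le> 3"
    and w: "w \<in> integer_lattice"
  defines "c \<equiv> 1 / (1152 * (2 + 18 * r) * real CARD('d))"
  shows "\<P>(\<omega> in M. walk Y n \<omega> = w)
    \<le> exp (- c * real N) + (9 / sqrt (c * real N * (real B)\<^sup>2 / real CARD('d))) ^ CARD('d)"
proof -
  \<comment> \<open>Dividing by the dimension pays for replacing the largest squared sine by the sum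
    of all of them.\<close>
  define \<kappa> where "\<kappa> = c * real N * (real B)\<^sup>2 / real CARD('d)"
  have c: "c > 0" using r by (simp add: c_def)
  have \<kappa>: "\<kappa> > 0" using c N B by (simp add: \<kappa>_def)
  \<comment> \<open>Half the number of grid points per axis, at least \<open>sqrt \<kappa>\<close>
    as the one-dimensional average requires.\<close>
  define L where "L = nat \<lceil>sqrt \<kappa>\<rceil>"
  have "sqrt \<kappa> > 0" using \<kappa> by simp
  then have L: "L \<ge> 1" "sqrt \<kappa> \<le> real L" unfolding L_def by linarith+
  let ?m = "2 * L"
  let ?G = "PiE UNIV (\<lambda>_::'d. {..<?m})"
  let ?C = "\<lambda>\<theta>. cmod (\<Sum>h\<in>paths n. of_real (path_prob n h) * cis (\<theta> \<bullet> (\<Sum>k=1..n. h k)))"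
  have bound: "?C \<theta> \<le> exp (- c * real N) + (\<Prod>i\<in>UNIV. exp (- \<kappa> * (sin (\<theta> $ i))\<^sup>2))" for \<theta>
  proof -
    define \<sigma> where "\<sigma> = Max (range (\<lambda>i. \<bar>sin (\<theta> $ i)\<bar>))"
    have "\<sigma> \<in> range (\<lambda>i. \<bar>sin (\<theta> $ i)\<bar>)" unfolding \<sigma>_def by (intro Max_in) auto
    then obtain i where i: "\<sigma> = \<bar>sin (\<theta> $ i)\<bar>" by auto
    have \<sigma>: "\<bar>sin (\<theta> $ j)\<bar> \<le> \<sigma>" for j unfolding \<sigma>_def by (intro Max_ge) auto
    have le: "?C \<theta> \<le> exp (- (c * real N * (min 1 (real B * \<sigma>))\<^sup>2))"
      using char_walk_le[OF p n window q r B, of \<theta> i] by (simp add: i c_def)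
    show ?thesis
    proof (cases "real B * \<sigma> \<ge> 1")
      case True
      then have "min 1 (real B * \<sigma>) = 1" by simp
      with le have "?C \<theta> \<le> exp (- c * real N)" by simp
      then show ?thesis by (simp add: add_increasing2 prod_nonneg)
    next
      case False
      have "(\<Sum>j\<in>UNIV. (sin (\<theta> $ j))\<^sup>2) \<le> (\<Sum>j\<in>(UNIV::'d set). \<sigma>\<^sup>2)"
        using \<sigma> by (intro sum_mono) (metis abs_ge_zero power2_abs power_mono)
      then have "\<kappa> * (\<Sum>j\<in>UNIV. (sin (\<theta> $ j))\<^sup>2) \<le> \<kappa> * (real CARD('d) * \<sigma>\<^sup>2)"
        using \<kappa> by (intro mult_left_mono) auto
      also have "\<dots> = c * real N * (min 1 (real B * \<sigma>))\<^sup>2"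
        using False by (simp add: \<kappa>_def power_mult_distrib)
      finally have "exp (- (c * real N * (min 1 (real B * \<sigma>))\<^sup>2)) \<le> exp (\<Sum>j\<in>UNIV. - \<kappa> * (sin (\<theta> $ j))\<^sup>2)"
        by (simp add: sum_negf sum_distrib_left)
      also have "\<dots> = (\<Prod>i\<in>UNIV. exp (- \<kappa> * (sin (\<theta> $ i))\<^sup>2))" by (simp add: exp_sum)
      finally show ?thesis using le exp_ge_zero[of "- c * real N"] by linarith
    qed
  qed
  have "\<P>(\<omega> in M. walk Y n \<omega> = w) \<le> (\<Sum>g\<in>?G. ?C (frequency ?m g)) / real (?m ^ CARD('d))"
    unfolding prob_walk_eq
  proof (rule point_mass_le_fourier_average)
    show "(\<Sum>k=1..n. h k) \<in> integer_lattice" if "h \<in> paths n" for h :: "nat \<Rightarrow> real ^ 'd"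
      using that steps_subset_integer_lattice by (intro sum_in_integer_lattice) blast
  qed (use L w finite_paths[of n] in \<open>auto simp: path_prob_nonneg\<close>)
  also have "\<dots> \<le> (\<Sum>g\<in>?G. exp (- c * real N) + (\<Prod>i\<in>UNIV. exp (- \<kappa> * (sin (frequency ?m g $ i))\<^sup>2))) / real (?m ^ CARD('d))"
    by (intro divide_right_mono sum_mono bound) auto
  also have "\<dots> = exp (- c * real N)
      + (\<Sum>g\<in>?G. \<Prod>i\<in>UNIV. exp (- \<kappa> * (sin (2 * pi * real (g i) / real ?m))\<^sup>2)) / real (?m ^ CARD('d))"
    using L by (simp add: sum.distrib add_divide_distrib card_PiE)
  also have "(\<Sum>g\<in>?G. \<Prod>i\<in>UNIV. exp (- \<kappa> * (sin (2 * pi * real (g i) / real ?m))\<^sup>2))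
      = (\<Prod>i\<in>(UNIV::'d set). \<Sum>j<?m. exp (- \<kappa> * (sin (2 * pi * real j / real ?m))\<^sup>2))"
    by (subst prod_sum_PiE) auto
  also have "\<dots> = (\<Sum>j<?m. exp (- \<kappa> * (sin (2 * pi * real j / real ?m))\<^sup>2)) ^ CARD('d)" by simp
  also have "\<dots> / real (?m ^ CARD('d)) = ((\<Sum>j<?m. exp (- \<kappa> * (sin (2 * pi * real j / real ?m))\<^sup>2)) / real ?m) ^ CARD('d)"
    unfolding of_nat_power by (rule power_divide[symmetric])
  also have "\<dots> \<le> (9 / sqrt \<kappa>) ^ CARD('d)"
    by (intro power_mono grid_average_exp_sin_squared_le \<kappa> L divide_nonneg_nonneg sum_nonneg) auto
  finally show ?thesis by (simp add: \<kappa>_def)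
qed

end

subsection \<open>Transience\<close>

lemma finite_integer_lattice_ball:
  "finite {w :: real ^ 'd::finite. w \<in> integer_lattice \<and> norm w \<le> R}"
proof -
  let ?A = "{w :: real ^ 'd. w \<in> integer_lattice \<and> norm w \<le> R}"
  let ?f = "\<lambda>(w :: real ^ 'd) i. \<lfloor>w $ i\<rfloor>"
  have "inj_on ?f ?A"
  proof (intro inj_onI)
    fix v w :: "real ^ 'd" assume vw: "v \<in> ?A" "w \<in> ?A" "?f v = ?f w"
    have "v $ i = w $ i" for i
    proof -
      have "v $ i = of_int \<lfloor>v $ i\<rfloor>" "w $ i = of_int \<lfloor>w $ i\<rfloor>"
        using vw by (auto simp: integer_lattice_def)
      with fun_cong[OF vw(3), of i] show ?thesis by simp
    qed
    then show "v = w" by (simp add: vec_eq_iff)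
  qed
  moreover have "?f ` ?A \<subseteq> PiE UNIV (\<lambda>_. {\<lfloor>- R\<rfloor>..\<lfloor>R\<rfloor>})"
  proof (intro image_subsetI PiE_I)
    fix w :: "real ^ 'd" and i assume "w \<in> ?A"
    then have "\<bar>w $ i\<bar> \<le> R" using component_le_norm_cart[of w i] by simp
    then show "\<lfloor>w $ i\<rfloor> \<in> {\<lfloor>- R\<rfloor>..\<lfloor>R\<rfloor>}" by (auto intro!: floor_mono)
  qed auto
  then have "finite (?f ` ?A)" by (rule finite_subset) (simp add: finite_PiE)
  ultimately show ?thesis by (rule finite_imageD[rotated])
qed

section \<open>Borel-Cantelli and the estimate on one window\<close>

context conservative_random_walk
begin

lemma walk_in_integer_lattice: "\<omega> \<in> space M \<Longrightarrow> walk Y n \<omega> \<in> integer_lattice"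
  unfolding walk_def
proof (intro sum_in_integer_lattice)
  fix k assume "\<omega> \<in> space M" "k \<in> {1..n}"
  then have "Y k \<omega> \<in> steps" by (intro step_in_steps) auto
  then show "Y k \<omega> \<in> integer_lattice" using steps_subset_integer_lattice by blast
qed

text \<open>By Borel-Cantelli each lattice site is almost surely left for good. A ball contains
  finitely many sites and countably many radii suffice, so almost surely every ball is left for
  good.\<close>

lemma strongly_transient_if_summable:
  assumes "\<And>w. w \<in> integer_lattice \<Longrightarrow> summable (\<lambda>n. \<P>(\<omega> in M. walk Y (Suc n) \<omega> = w))"
  shows "strongly_transient M (walk Y)"
proof -
  let ?F = "\<lambda>R::nat. {w :: real ^ 'd. w \<in> integer_lattice \<and> norm w \<le> real R}"
  have leaves: "AE \<omega> in M. \<forall>\<^sub>F n in sequentially. walk Y (Suc n) \<omega> \<noteq> w" if "w \<in> integer_lattice" for w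
  proof -
    have "AE \<omega> in M. \<forall>\<^sub>F n in sequentially. \<omega> \<in> space M - {\<omega> \<in> space M. walk Y (Suc n) \<omega> = w}"
      using assms[OF that] walk_event
      by (intro borel_cantelli_AE1) (auto simp: emeasure_eq_measure)
    then show ?thesis by eventually_elim (auto elim: eventually_mono)
  qed
  have "AE \<omega> in M. \<forall>R. \<forall>w\<in>?F R. \<forall>\<^sub>F n in sequentially. walk Y (Suc n) \<omega> \<noteq> w"
    unfolding AE_all_countable
    by (intro allI AE_finite_allI finite_integer_lattice_ball leaves) auto
  moreover have "AE \<omega> in M. \<omega> \<in> space M" by simp
  ultimately have "AE \<omega> in M. filterlim (\<lambda>n. norm (walk Y n \<omega>)) at_top sequentially"
  proof eventually_elim
    case (elim \<omega>)
    have "filterlim (\<lambda>n. norm (walk Y (Suc n) \<omega>)) at_top sequentially"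
      unfolding filterlim_at_top
    proof
      fix Z :: real
      obtain R :: nat where R: "Z \<le> real R" using real_arch_simple by blast
      have "\<forall>\<^sub>F n in sequentially. \<forall>w\<in>?F R. walk Y (Suc n) \<omega> \<noteq> w"
        using elim by (intro eventually_ball_finite finite_integer_lattice_ball) auto
      then show "\<forall>\<^sub>F n in sequentially. Z \<le> norm (walk Y (Suc n) \<omega>)"
      proof eventually_elim
        case (elim n)
        then show ?case using walk_in_integer_lattice[OF \<open>\<omega> \<in> space M\<close>, of "Suc n"] R by force
      qed
    qed
    then show ?case by (rule filterlim_sequentially_Suc[THEN iffD1])
  qed
  then show ?thesis by (simp add: strongly_transient_def)
qed

text \<open>The window of length \<open>L\<close> is cut into \<open>N\<close> blocks of length
  \<open>B\<close> of order \<open>1 / q\<close>. From \<open>N * B >= x / 4\<close> follow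
  \<open>N >= p n * x / (12 * r)\<close>, which gives the exponential term, and
  \<open>N * B^2 >= x / (2 * p n)\<close>, which gives the power term.\<close>

lemma prob_walk_le_window:
  assumes p: "\<And>k. k \<ge> 1 \<Longrightarrow> p k \<in> {0..1}"
    and L: "L < n" "x \<le> 2 * real L" and x: "x > 0"
    and window: "\<And>k. n - L \<le> k \<Longrightarrow> k \<le> n \<Longrightarrow> q \<le> p k \<and> p k \<le> r * q"
    and q: "q > 0" and r: "r \<ge> 1" and large: "p n * x \<ge> 6 * r"
    and w: "w \<in> integer_lattice"
  defines "c \<equiv> 1 / (1152 * (2 + 18 * r) * real CARD('d))"
  shows "\<P>(\<omega> in M. walk Y n \<omega> = w)
    \<le> exp (- c * (p n * x / (12 * r))) + (162 * real CARD('d) / c * (p n / x)) powr (real CARD('d) / 2)"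
proof -
  \<comment> \<open>Rounding up adds at most \<open>q <= 1\<close> to \<open>q * B\<close>, so
    \<open>2 <= q * B <= 3\<close>.\<close>
  define B where "B = nat \<lceil>2 / q\<rceil>"
  define N where "N = L div B"
  have c: "c > 0" using r by (simp add: c_def)
  have qn: "q \<le> p n" "p n \<le> r * q" "p n \<le> 1" using window[of n] p[of n] L by auto
  have "2 / q > 0" using q by simp
  then have B: "real B \<ge> 2 / q" "real B \<le> 2 / q + 1" unfolding B_def by linarith+
  have qB: "2 \<le> q * real B" using B(1) q by (simp add: field_simps)
  have "q * real B \<le> q * (2 / q + 1)" using B(2) q by (intro mult_left_mono) auto
  also have "\<dots> = 2 + q" using q by (simp add: field_simps)
  finally have qB3: "q * real B \<le> 3" using qn by linarith
  have "q * real B \<le> 1 * real B" using qn by (intro mult_right_mono) auto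
  then have B2: "B \<ge> 2" using qB by linarith
  \<comment> \<open>Largeness of \<open>p n * x\<close> ensures that a block fits:
    \<open>q * L >= 3 >= q * B\<close>.\<close>
  have xq: "6 \<le> x * q" "p n * x / r \<le> x * q"
  proof -
    have "p n * x \<le> (r * q) * x" using qn x by (intro mult_right_mono) auto
    then show a: "p n * x / r \<le> x * q" using r by (simp add: field_simps)
    have "6 \<le> p n * x / r" using large r by (simp add: field_simps)
    with a show "6 \<le> x * q" by linarith
  qed
  have "x * q \<le> 2 * real L * q" using L(2) q by (intro mult_right_mono) auto
  also have "\<dots> = 2 * (q * real L)" by simp
  finally have "q * real B \<le> q * real L" using qB3 xq(1) by linarith
  then have "B \<le> L" using q by (simp add: mult_le_cancel_left_pos)
  then have N1: "N \<ge> 1" using B2 unfolding N_def by (simp add: Suc_le_eq div_greater_zero_iff)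
  have "L < N * B + B" unfolding N_def using B2 dividend_less_div_times[of B L] by linarith
  moreover have "B \<le> N * B" using N1 by simp
  ultimately have "L < 2 * (N * B)" by linarith
  then have NB: "real L \<le> 2 * (real N * real B)" by (metis less_imp_le of_nat_le_iff of_nat_mult of_nat_numeral)
  have NBL: "N * B \<le> L" by (simp add: N_def)
  have x4: "x \<le> 4 * (real N * real B)" using L NB by linarith
  have "x * q \<le> 4 * (real N * real B) * q" using x4 q by (intro mult_right_mono) auto
  also have "\<dots> = 4 * real N * (q * real B)" by simp
  also have "\<dots> \<le> 4 * real N * 3" using qB3 by (intro mult_left_mono) auto
  finally have "p n * x / r \<le> 4 * real N * 3" using xq(2) by (meson order_trans)
  then have "p n * x / (12 * r) \<le> real N" using r by (simp add: divide_le_eq mult_ac)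
  then have e: "exp (- c * real N) \<le> exp (- c * (p n * x / (12 * r)))"
    using mult_left_mono[of "p n * x / (12 * r)" "real N" c] c by simp
  have "1 / q \<ge> 1 / p n" using qn q by (intro divide_left_mono) auto
  then have "real B \<ge> 2 / p n" using B(1) by linarith
  then have "x / 4 * (2 / p n) \<le> (real N * real B) * real B"
    using x4 qn q x by (intro mult_mono) auto
  then have NB2: "x / (2 * p n) \<le> real N * (real B)\<^sup>2" by (simp add: power2_eq_square mult.assoc)
  define \<kappa> where "\<kappa> = c * real N * (real B)\<^sup>2 / real CARD('d)"
  \<comment> \<open>Chosen so that \<open>81 / y\<close> is the lower bound obtained for \<kappa>,
    hence \<open>9 / sqrt \<kappa> <= sqrt y\<close>; 162 = 2 * 81.\<close>
  define y where "y = 162 * real CARD('d) / c * (p n / x)"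
  have pn: "p n > 0" using qn q by linarith
  have y: "y > 0" using pn c x by (simp add: y_def)
  have "81 / y = c / real CARD('d) * (x / (2 * p n))" using c x pn by (simp add: y_def field_simps)
  also have "\<dots> \<le> c / real CARD('d) * (real N * (real B)\<^sup>2)" using c by (intro mult_left_mono NB2) auto
  also have "\<dots> = \<kappa>" by (simp add: \<kappa>_def)
  finally have \<kappa>y: "81 / y \<le> \<kappa>" .
  have "sqrt (81 / y) \<le> sqrt \<kappa>" using \<kappa>y by simp
  moreover have s81: "sqrt (81 / y) = 9 / sqrt y" by (simp add: real_sqrt_divide)
  moreover have "\<kappa> > 0" using \<kappa>y y by (meson divide_pos_pos less_le_trans zero_less_numeral)
  ultimately have "9 / sqrt \<kappa> \<le> 9 / (9 / sqrt y)"
    using y by (intro divide_left_mono mult_pos_pos) auto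
  then have "9 / sqrt \<kappa> \<le> sqrt y" by simp
  moreover have "\<kappa> \<ge> 0" using c by (simp add: \<kappa>_def)
  ultimately have "(9 / sqrt \<kappa>) ^ CARD('d) \<le> (sqrt y) ^ CARD('d)" by (intro power_mono) auto
  also have "\<dots> = y powr (real CARD('d) / 2)"
    using y by (simp add: powr_half_sqrt[symmetric] powr_realpow[symmetric] powr_powr)
  finally have k: "(9 / sqrt \<kappa>) ^ CARD('d) \<le> y powr (real CARD('d) / 2)" .
  have "\<P>(\<omega> in M. walk Y n \<omega> = w) \<le> exp (- c * real N) + (9 / sqrt \<kappa>) ^ CARD('d)"
    unfolding \<kappa>_def c_def
    by (rule prob_walk_le[where q=q and B=B]) (use p L NBL N1 window q r B2 qB qB3 w in auto)
  with e k show ?thesis unfolding y_def by linarith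
qed

end

theorem theorem5p3:
  fixes M :: "'a measure" and p :: "nat \<Rightarrow> real" and Y :: "nat \<Rightarrow> 'a \<Rightarrow> real ^ 'd"
    and \<epsilon> \<epsilon>' r :: real
  assumes "CARD('d) \<ge> 2"
    and "p 1 = 1"
    and "\<And>n. n \<ge> 2 \<Longrightarrow> p n \<in> {0..1}"
    and "conservative_random_walk M p Y"
    and "\<epsilon> > \<epsilon>'" and "\<epsilon>' > 0" and "r > 1"
    and "\<forall>\<^sub>F n in sequentially. window_min p (1 - \<epsilon>') n > 0"
    and "limsup (\<lambda>n. ereal (window_max p (1 - \<epsilon>') n / window_min p (1 - \<epsilon>') n)) < ereal r"
    and "filterlim (\<lambda>n. p n * real n powr (1 - \<epsilon>) / ln (real n)) at_top sequentially"
    and "summable (\<lambda>n. (p (Suc n) / real (Suc n) powr (1 - \<epsilon>)) powr (real CARD('d) / 2))"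
  shows "(\<forall>w\<in>integer_lattice. summable (\<lambda>n. \<P>(\<omega> in M. walk Y (Suc n) \<omega> = w)))
    \<and> strongly_transient M (walk Y)"
proof -
  interpret conservative_random_walk M p Y by fact
  have p: "p k \<in> {0..1}" if "k \<ge> 1" for k
    using assms(2) assms(3)[of k] that by (cases "k = 1") auto
  define c where "c = 1 / (1152 * (2 + 18 * r) * real CARD('d))"
  define K where "K = (162 * real CARD('d) / c) powr (real CARD('d) / 2)"
  \<comment> \<open>The summand \<open>6 * r\<close> makes a block fit into the window. The summand
    \<open>24 * r / c\<close> gives \<open>c * Z * ln n / (12 * r) >= 2 * ln n\<close>, so the
    exponential term is at most \<open>1 / n^2\<close>.\<close>
  define Z where "Z = 6 * r + 24 * r / c"
  let ?x = "\<lambda>n. real n powr (1 - \<epsilon>)" and ?q = "window_min p (1 - \<epsilon>')"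
  have c: "c > 0" using assms(7) by (simp add: c_def)
  have "24 * r / c > 0" using c assms(7) by simp
  then have Z: "Z \<ge> 6 * r" "Z \<ge> 24 * r / c" "Z \<ge> 1" using assms(7) unfolding Z_def by linarith+
  have "\<forall>\<^sub>F n in sequentially. ereal (window_max p (1 - \<epsilon>') n / ?q n) < ereal r"
    by (rule Limsup_lessD) fact
  moreover have "\<forall>\<^sub>F n in sequentially. Z \<le> p n * ?x n / ln (real n)"
    using assms(10) by (auto simp: filterlim_at_top)
  ultimately have bound: "\<forall>\<^sub>F n in sequentially. \<forall>w\<in>integer_lattice.
      \<P>(\<omega> in M. walk Y n \<omega> = w) \<le> 1 / (real n)\<^sup>2 + K * (p n / ?x n) powr (real CARD('d) / 2)"
    using assms(8) eventually_ge_at_top[of 3]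
  proof eventually_elim
    case (elim n)
    \<comment> \<open>The threshold 3 exceeds e, so \<open>ln n >= 1\<close> and
      \<open>p n * ?x n\<close> is itself at least \<open>Z\<close>.\<close>
    have n: "real n \<ge> 3" using elim by simp
    have "exp 1 \<le> real n" using exp_le n by linarith
    then have ln: "ln (real n) \<ge> 1" using n by (subst ln_ge_iff) auto
    have pn: "p n \<in> {0..1}" using p[of n] elim by simp
    have px: "p n * ?x n \<ge> Z * ln (real n)" using elim(2) ln by (simp add: le_divide_eq)
    moreover have "Z * ln (real n) \<ge> Z * 1" using Z ln by (intro mult_left_mono) auto
    ultimately have pxZ: "p n * ?x n \<ge> Z" by linarith
    moreover have "p n * ?x n \<le> 1 * ?x n" using pn by (intro mult_right_mono) auto
    ultimately have x1: "?x n \<ge> 1" using Z by linarith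
    define W where "W = real n powr (1 - \<epsilon>')"
    \<comment> \<open>The order \<epsilon>' < \<epsilon> makes the window at least as long as
      \<open>?x n\<close>, and \<epsilon>' > 0 keeps it shorter than \<open>n\<close>, so
      \<open>n - k\<close> does not truncate.\<close>
    have W: "W \<ge> ?x n" unfolding W_def using n assms(5) by (intro powr_mono) auto
    have "W < real n powr 1" unfolding W_def using n assms(6) by (intro powr_less_mono) auto
    then have Wn: "W < real n" using n by simp
    define L where "L = nat \<lfloor>W\<rfloor>"
    \<comment> \<open>Because \<open>W >= ?x n >= 1\<close>, the floor is at least 1, so that
      \<open>?x n <= W < L + 1 <= 2 * L\<close>.\<close>
    have L: "real L \<le> W" "W < real L + 1" "L \<ge> 1" using W x1 unfolding L_def by linarith+
    let ?I = "{k. real k \<le> real n powr (1 - \<epsilon>')}"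
    have "?I \<subseteq> {..L}" using L(2) by (auto simp: W_def[symmetric])
    then have fin: "finite ?I" by (rule finite_subset) simp
    have window: "?q n \<le> p k \<and> p k \<le> r * ?q n" if "n - L \<le> k" "k \<le> n" for k
    proof -
      have "n - k \<in> ?I" using that L(1) by (simp add: W_def[symmetric])
      moreover have "p k = p (n - (n - k))" using that by simp
      ultimately have k: "p k \<in> (\<lambda>k. p (n - k)) ` ?I" by blast
      have "?q n \<le> p k" unfolding window_min_def using k fin by (intro Min_le) auto
      moreover have "p k \<le> window_max p (1 - \<epsilon>') n" unfolding window_max_def using k fin by (intro Max_ge) auto
      \<comment> \<open>Clearing the denominator rests on the eventual positivity of the window
        minimum; a zero denominator would make the quotient 0.\<close>
      moreover have "window_max p (1 - \<epsilon>') n \<le> r * ?q n" using elim by (simp add: divide_less_eq)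
      ultimately show ?thesis by linarith
    qed
    show ?case
    proof
      fix w :: "real ^ 'd" assume w: "w \<in> integer_lattice"
      have "\<P>(\<omega> in M. walk Y n \<omega> = w)
          \<le> exp (- c * (p n * ?x n / (12 * r))) + (162 * real CARD('d) / c * (p n / ?x n)) powr (real CARD('d) / 2)"
        unfolding c_def
      proof (rule prob_walk_le_window[where q="?q n"])
        show "L < n" using L Wn by linarith
        show "?x n \<le> 2 * real L" using L W by linarith
      qed (use p elim assms(7) window pxZ Z x1 w in auto)
      also have "(162 * real CARD('d) / c * (p n / ?x n)) powr (real CARD('d) / 2)
          = K * (p n / ?x n) powr (real CARD('d) / 2)"
        unfolding K_def by (rule powr_mult)
      also have "exp (- c * (p n * ?x n / (12 * r))) \<le> exp (- (2 * ln (real n)))"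
      proof -
        have "24 * r / c * ln (real n) \<le> Z * ln (real n)" using Z ln by (intro mult_right_mono) auto
        also note px
        finally have "2 * ln (real n) \<le> c * (p n * ?x n / (12 * r))"
          using c assms(7) by (simp add: field_simps)
        then show ?thesis by simp
      qed
      also have "exp (- (2 * ln (real n))) = 1 / (real n)\<^sup>2"
        using n by (simp add: exp_minus exp_double inverse_eq_divide)
      finally show "\<P>(\<omega> in M. walk Y n \<omega> = w) \<le> 1 / (real n)\<^sup>2 + K * (p n / ?x n) powr (real CARD('d) / 2)"
        by simp
    qed
  qed
  have summ: "summable (\<lambda>n. \<P>(\<omega> in M. walk Y (Suc n) \<omega> = w))" if w: "w \<in> integer_lattice" for w
  proof (rule summable_comparison_test_ev)
    show "summable (\<lambda>n. 1 / (real (Suc n))\<^sup>2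
        + K * (p (Suc n) / ?x (Suc n)) powr (real CARD('d) / 2))"
      using inverse_power_summable[of 2, where 'a=real]
      by (intro summable_add summable_mult assms(11) summable_Suc_iff[THEN iffD2]) (simp_all add: inverse_eq_divide)
    have "\<forall>\<^sub>F n in sequentially. \<forall>w\<in>integer_lattice. \<P>(\<omega> in M. walk Y (Suc n) \<omega> = w)
        \<le> 1 / (real (Suc n))\<^sup>2 + K * (p (Suc n) / ?x (Suc n)) powr (real CARD('d) / 2)"
      using bound by (rule eventually_sequentially_Suc[THEN iffD2])
    then show "\<forall>\<^sub>F n in sequentially. norm (\<P>(\<omega> in M. walk Y (Suc n) \<omega> = w))
        \<le> 1 / (real (Suc n))\<^sup>2 + K * (p (Suc n) / ?x (Suc n)) powr (real CARD('d) / 2)"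
      by eventually_elim (use w in simp)
  qed
  then show ?thesis using strongly_transient_if_summable by blast
qed

end
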